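(* Let $R\ge R_0=\|x^0-x^*\|$ and let $Q=B_{3R}(x^* )$. Assume that - (bounded variance) $\mathbb{E}\|F_\xi(x)-F(x)\|^2\le\sigma^2$ for all $x\in Q$; - (Lipschitzness) $\|F(x)-F(y)\|\le L\|x-y\|$ for all $x,y\in Q$; - (quasi-strong monotonicity) for some $\mu\ge0$, $\langle F(x),x-x^*\rangle\ge\mu\|x-x^*\|^2$ for all $x\in Q$, where $x^*$ is the unique solution of $F(x)=0$. Let $\gamma_1=\gamma_2=\gamma$ and $$0<\gamma\le\frac1{650L\ln\frac{6(K+1)}\beta},\qquad\lambda_{1,k}=\lambda_{2,k}=\lambda_k=\frac{\exp(-\gamma\mu(1+k/2))R}{120\gamma\ln\frac{6(K+1)}\beta},$$ $$m_{1,k}=m_{2,k}=m_k\ge\max\left\{1,\frac{264600\gamma^2(K+1)\sigma^2\ln\frac{6(K+1)}\beta}{\exp(-\gamma\mu k)R^2}\right\}$$ for some integer $K\ge0$ and $\beta\in(0,1]$ such that $\ln\frac{6(K+1)}\beta\ge1$. Then, after $K$ iterations, the iterates produced by clipped-SEG satisfy with probability at least $1-\beta$ $$\|x^{K+1}-x^*\|^2\le2\exp(-\gamma\mu(K+1))R^2.$$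
   Context: Notation: $\|\cdot\|$ is the Euclidean norm, $B_r(x)=\{u\in\mathbb{R}^d:\|u-x\|\le r\}$. $F:\mathbb{R}^d\to\mathbb{R}^d$ with $F(x)=\mathbb{E}_{\xi\sim\mathcal D}[F_\xi(x)]$ for all $x$, where $F_\xi(x)$ is a stochastic oracle; $x^0$ is the starting point. $\mathrm{clip}(y,\lambda)=\min\{1,\lambda/\|y\|\}y$ for $y\ne0$, $\mathrm{clip}(0,\lambda)=0$, for $\lambda>0$. clipped-SEG, for $k=0,1,\dots$: $\widetilde x^k=x^k-\gamma_1\widetilde F_{\boldsymbol\xi_1^k}(x^k)$, $x^{k+1}=x^k-\gamma_2\widetilde F_{\boldsymbol\xi_2^k}(\widetilde x^k)$, where $\widetilde F_{\boldsymbol\xi_1^k}(x^k)=\mathrm{clip}\left(\frac1{m_{1,k}}\sum_{i=1}^{m_{1,k}}F_{\xi_1^{i,k}}(x^k),\lambda_{1,k}\right)$, $\widetilde F_{\boldsymbol\xi_2^k}(\widetilde x^k)=\mathrm{clip}\left(\frac1{m_{2,k}}\sum_{i=1}^{m_{2,k}}F_{\xi_2^{i,k}}(\widetilde x^k),\lambda_{2,k}\right)$ and all $\xi_1^{i,k},\xi_2^{i,k}$ are independent samples from $\mathcal D$. Clipping levels are positive (so $R>0$), batchsizes are positive integers. *)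

theory Defs
  imports "HOL-Probability.Probability"
begin

definition clip :: "'a::real_normed_vector \<Rightarrow> real \<Rightarrow> 'a" where
  "clip y lam = (if y = 0 then 0 else min 1 (lam / norm y) *\<^sub>R y)"

definition clipped_batch ::
  "('s \<Rightarrow> 'a \<Rightarrow> 'a) \<Rightarrow> nat \<Rightarrow> real \<Rightarrow> (nat \<Rightarrow> 's) \<Rightarrow> 'a \<Rightarrow> 'a::real_normed_vector" where
  "clipped_batch G m lam \<xi> x = clip ((1 / real m) *\<^sub>R (\<Sum>i = 1..m. G (\<xi> i) x)) lam"

text \<open>
  Here \<open>G s x\<close> is the oracle value at the point \<open>x\<close> for the sample \<open>s\<close>. The arguments
  \<open>\<xi>1\<close>, \<open>\<xi>2\<close> are realisations of the samples: \<open>\<xi>1 i k\<close> is the \<open>i\<close>-th sample (\<open>i \<ge> 1\<close>)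
  of the batch used in the extrapolation step of iteration \<open>k\<close>, and \<open>\<xi>2 i k\<close> the one used
  in its update step.
\<close>

primrec clipped_SEG ::
  "('s \<Rightarrow> 'a \<Rightarrow> 'a) \<Rightarrow> real \<Rightarrow> real \<Rightarrow> (nat \<Rightarrow> real) \<Rightarrow> (nat \<Rightarrow> real) \<Rightarrow> (nat \<Rightarrow> nat) \<Rightarrow> (nat \<Rightarrow> nat) \<Rightarrow>
   (nat \<Rightarrow> nat \<Rightarrow> 's) \<Rightarrow> (nat \<Rightarrow> nat \<Rightarrow> 's) \<Rightarrow> 'a \<Rightarrow> nat \<Rightarrow> 'a::real_normed_vector" where
  "clipped_SEG G \<gamma>1 \<gamma>2 lam1 lam2 m1 m2 \<xi>1 \<xi>2 x0 0 = x0"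
| "clipped_SEG G \<gamma>1 \<gamma>2 lam1 lam2 m1 m2 \<xi>1 \<xi>2 x0 (Suc k) =
     (let x = clipped_SEG G \<gamma>1 \<gamma>2 lam1 lam2 m1 m2 \<xi>1 \<xi>2 x0 k;
          xt = x - \<gamma>1 *\<^sub>R clipped_batch G (m1 k) (lam1 k) (\<lambda>i. \<xi>1 i k) x
      in x - \<gamma>2 *\<^sub>R clipped_batch G (m2 k) (lam2 k) (\<lambda>i. \<xi>2 i k) xt)"

end

theory Submission
  imports Defs
begin

text \<open>
  Write \<open>A = ln (6 (K + 1) / \<beta>)\<close>, let \<open>r\<^sub>k = exp (\<gamma> \<mu> k) \<parallel>x\<^sup>k - x\<^sup>*\<parallel>\<^sup>2 / R\<^sup>2\<close> and \<open>\<delta> = A / (K + 1)\<close>. While \<open>r\<^sub>k \<le> 2\<close>,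
  the points \<open>x\<^sup>k\<close> and \<open>x\<^sup>k - \<gamma> g\<close> lie in the ball on which the assumptions hold, the clipping level
  is at least twice the norm of the operator there, and the extragradient inequality bounds \<open>r\<^bsub>k+1\<^esub> - r\<^sub>k\<close>
  by clipping noise that is bounded by \<open>O(1/A)\<close>. Hence \<open>exp (2 A r\<^bsub>k+1\<^esub>)\<close> is at most
  \<open>1 + linear term + quadratic terms\<close> times \<open>exp (2 A r\<^sub>k)\<close>, and averaging over the two fresh batches costs a
  factor of at most \<open>1 + \<delta>\<close>. So
  \<open>min 1 ((1 + \<delta>)\<^bsup>K+1-k\<^esup> exp (2 A (r\<^sub>k - 2)))\<close> is a supermartingale; no stopping time is needed, as it
  equals its maximal value \<open>1\<close> as soon as \<open>r\<^sub>k > 2\<close>. It starts below \<open>exp (A - 2 A) \<le> \<beta>\<close> and ends above the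
  indicator of failure.
\<close>

section \<open>Clipping\<close>

lemma norm_clip_le:
  assumes "0 < lam" shows "norm (clip y lam) \<le> lam"
proof (cases "y = 0")
  case True
  then show ?thesis using assms by (simp add: clip_def)
next
  case False
  have "norm (clip y lam) = min 1 (lam / norm y) * norm y"
    using False assms by (simp add: clip_def)
  also have "\<dots> \<le> lam / norm y * norm y"
    by (intro mult_right_mono) auto
  finally show ?thesis using False by simp
qed

lemma clip_cases:
  assumes "0 < lam"
  obtains "norm y \<le> lam" "clip y lam = y"
  | "lam < norm y" "clip y lam = (lam / norm y) *\<^sub>R y"
  using assms by (cases "norm y \<le> lam"; cases "y = 0") (auto simp: clip_def min_def field_simps)

text \<open>Clipping is the metric projection onto the ball of radius \<open>lam\<close>, which
  contains \<open>f\<close>. In the clipped case the two squared distances differ by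
  \<open>1 - c\<close> times a quantity that Cauchy-Schwarz bounds below by
  \<open>(1 - c) * (norm y)\<^sup>2\<close>.\<close>

lemma clip_nonexpansive:
  fixes y f :: "'a::real_inner"
  assumes lam: "0 < lam" and f: "norm f \<le> lam"
  shows "norm (clip y lam - f) \<le> norm (y - f)"
  using lam
proof (cases rule: clip_cases[of lam y])
  case 2
  define c where "c = lam / norm y"
  have y: "0 < norm y" using 2 lam by linarith
  have c: "0 < c" "c < 1" "c * norm y = lam" using 2 lam y by (auto simp: c_def field_simps)
  have "y \<bullet> f \<le> norm y * norm f" by (rule norm_cauchy_schwarz)
  also have "\<dots> \<le> norm y * (c * norm y)" using f c y by (simp add: mult_left_mono)
  finally have yf: "y \<bullet> f \<le> c * (norm y)\<^sup>2" by (simp add: power2_eq_square mult_ac)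
  have "(norm (y - f))\<^sup>2 - (norm (c *\<^sub>R y - f))\<^sup>2
      = (1 - c) * ((1 + c) * (norm y)\<^sup>2 - 2 * (y \<bullet> f))"
    by (simp add: power2_norm_eq_inner inner_diff inner_commute algebra_simps)
  moreover have "(1 + c) * (norm y)\<^sup>2 - 2 * (y \<bullet> f) \<ge> (1 + c) * (norm y)\<^sup>2 - 2 * (c * (norm y)\<^sup>2)"
    using yf by simp
  moreover have "(1 + c) * (norm y)\<^sup>2 - 2 * (c * (norm y)\<^sup>2) = (1 - c) * (norm y)\<^sup>2"
    by (simp add: algebra_simps)
  moreover have "(1 - c) * (norm y)\<^sup>2 \<ge> 0" using c by simp
  ultimately have "(norm (c *\<^sub>R y - f))\<^sup>2 \<le> (norm (y - f))\<^sup>2"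
    using c by (smt (verit) mult_nonneg_nonneg)
  then show ?thesis using 2 by (simp add: c_def power2_le_iff_abs_le)
qed simp

text \<open>Clipping removes the excess \<open>norm y - lam\<close>, which is at most
  \<open>norm (y - f) - lam / 2\<close>; nonnegativity of the square of
  \<open>norm (y - f) - lam\<close> turns this into a second-order bound. The bias is thus paid for
  by the variance.\<close>

lemma clip_bias:
  fixes y f :: "'a::real_inner"
  assumes lam: "0 < lam" and f: "norm f \<le> lam / 2"
  shows "norm (y - clip y lam) \<le> (norm (y - f))\<^sup>2 / (2 * lam)"
  using lam
proof (cases rule: clip_cases[of lam y])
  case 1
  then show ?thesis using lam by simp
next
  case 2
  have y: "0 < norm y" using 2 lam by linarith
  have "y - clip y lam = (1 - lam / norm y) *\<^sub>R y"
    using 2 by (simp add: algebra_simps)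
  then have "norm (y - clip y lam) = \<bar>1 - lam / norm y\<bar> * norm y" by simp
  also have "\<dots> = norm y - lam" using 2 y lam by (simp add: field_simps abs_if)
  also have "\<dots> \<le> norm (y - f) - lam / 2"
    using norm_triangle_ineq2[of y f] f by linarith
  also have "\<dots> \<le> (norm (y - f))\<^sup>2 / (2 * lam)"
  proof -
    have "0 \<le> (norm (y - f) - lam)\<^sup>2" by simp
    then show ?thesis using lam by (simp add: field_simps power2_eq_square)
  qed
  finally show ?thesis .
qed

section \<open>Exponential moments and independence\<close>

lemma exp_le_quadratic:
  fixes y :: real
  assumes "y \<le> 1" shows "exp y \<le> 1 + y + y\<^sup>2"
proof (cases "0 \<le> y")
  case True
  then show ?thesis using assms exp_bound by blast
next
  case False
  \<comment> \<open>For negative \<open>y\<close>, \<open>exp y\<close> is at most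
    \<open>1 / (1 - y)\<close>, while \<open>(1 + y + y\<^sup>2) * (1 - y) = 1 - y ^ 3\<close>
    exceeds 1.\<close>
  have "1 - y \<le> exp (- y)" using exp_ge_add_one_self[of "-y"] by simp
  then have "exp y * (1 - y) \<le> exp y * exp (- y)" by (intro mult_left_mono) auto
  also have "\<dots> = 1" by (simp add: exp_minus)
  also have "1 \<le> (1 + y + y\<^sup>2) * (1 - y)"
  proof -
    have "(1 + y + y\<^sup>2) * (1 - y) = 1 + (- y) * y\<^sup>2"
      by (simp add: algebra_simps power2_eq_square)
    moreover have "(- y) * y\<^sup>2 \<ge> 0" using False by (intro mult_nonneg_nonneg) auto
    ultimately show ?thesis by simp
  qed
  finally show ?thesis using False by (simp add: mult_le_cancel_right)
qed

text \<open>Here \<open>p\<close> is the part of varying sign whose mean is to cancel, so its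
  first-order coefficient stays exactly 1; for the nonnegative \<open>t\<close>, doubling the
  coefficient absorbs the square.\<close>

lemma exp_add_le:
  fixes p t :: real
  assumes "\<bar>p\<bar> \<le> 1/2" "0 \<le> t" "t \<le> 1/2"
  shows "exp (p + t) \<le> 1 + p + 2 * p\<^sup>2 + 2 * t"
proof -
  have "exp (p + t) \<le> 1 + (p + t) + (p + t)\<^sup>2"
    using assms by (intro exp_le_quadratic) auto
  moreover have "(p + t)\<^sup>2 \<le> 2 * p\<^sup>2 + 2 * t\<^sup>2"
    using zero_le_power2[of "p - t"] by (simp add: power2_eq_square algebra_simps)
  moreover have "t\<^sup>2 \<le> (1/2) * t"
    using assms unfolding power2_eq_square by (intro mult_right_mono) auto
  ultimately show ?thesis by linarith
qed

section \<open>Independent variables and sample means\<close>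

text \<open>Fubini on the product law stands in for conditioning on \<open>X\<close>: an independent
  copy of \<open>Y\<close> is averaged out while \<open>X\<close> stays frozen.\<close>

lemma (in prob_space) nn_integral_indep_var:
  assumes ind: "indep_var S X T Y" and f [measurable]: "(\<lambda>(x, y). f x y) \<in> borel_measurable (S \<Otimes>\<^sub>M T)"
  shows "(\<integral>\<^sup>+ \<omega>. f (X \<omega>) (Y \<omega>) \<partial>M) = (\<integral>\<^sup>+ \<omega>. (\<integral>\<^sup>+ \<omega>'. f (X \<omega>) (Y \<omega>') \<partial>M) \<partial>M)"
proof -
  have [measurable]: "X \<in> measurable M S" "Y \<in> measurable M T"
    using ind by (blast dest: indep_var_rv1 indep_var_rv2)+
  interpret X: prob_space "distr M S X" by (rule prob_space_distr) simp
  interpret Y: prob_space "distr M T Y" by (rule prob_space_distr) simp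
  have "(\<integral>\<^sup>+ \<omega>. f (X \<omega>) (Y \<omega>) \<partial>M) = (\<integral>\<^sup>+ z. (case z of (x, y) \<Rightarrow> f x y) \<partial>distr M (S \<Otimes>\<^sub>M T) (\<lambda>\<omega>. (X \<omega>, Y \<omega>)))"
    by (subst nn_integral_distr) auto
  also have "\<dots> = (\<integral>\<^sup>+ z. (case z of (x, y) \<Rightarrow> f x y) \<partial>(distr M S X \<Otimes>\<^sub>M distr M T Y))"
    using ind by (simp add: indep_var_distribution_eq)
  also have "\<dots> = (\<integral>\<^sup>+ x. (\<integral>\<^sup>+ y. f x y \<partial>distr M T Y) \<partial>distr M S X)"
    by (subst Y.nn_integral_fst[symmetric]) auto
  also have "\<dots> = (\<integral>\<^sup>+ \<omega>. (\<integral>\<^sup>+ \<omega>'. f (X \<omega>) (Y \<omega>') \<partial>M) \<partial>M)"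
  proof -
    have "(\<integral>\<^sup>+ x. (\<integral>\<^sup>+ y. f x y \<partial>distr M T Y) \<partial>distr M S X)
        = (\<integral>\<^sup>+ \<omega>. (\<integral>\<^sup>+ y. f (X \<omega>) y \<partial>distr M T Y) \<partial>M)"
      by (rule nn_integral_distr) auto
    also have "\<dots> = (\<integral>\<^sup>+ \<omega>. (\<integral>\<^sup>+ \<omega>'. f (X \<omega>) (Y \<omega>') \<partial>M) \<partial>M)"
      by (intro nn_integral_cong nn_integral_distr) auto
    finally show ?thesis .
  qed
  finally show ?thesis .
qed

text \<open>The expectation factors in each coordinate, and the factor coming from \<open>X\<close>
  is zero.\<close>

lemma (in prob_space) indep_var_inner_zero_mean:
  fixes X Y :: "'a \<Rightarrow> 'b::euclidean_space"
  assumes ind: "indep_var borel X borel Y" and int: "integrable M X" "integrable M Y"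
    and mean: "expectation X = 0"
  shows "integrable M (\<lambda>\<omega>. X \<omega> \<bullet> Y \<omega>)" "expectation (\<lambda>\<omega>. X \<omega> \<bullet> Y \<omega>) = 0"
proof -
  have *: "integrable M (\<lambda>\<omega>. (X \<omega> \<bullet> b) * (Y \<omega> \<bullet> b)) \<and> expectation (\<lambda>\<omega>. (X \<omega> \<bullet> b) * (Y \<omega> \<bullet> b)) = 0"
    for b :: 'b
  proof -
    have i: "indep_var borel (\<lambda>\<omega>. X \<omega> \<bullet> b) borel (\<lambda>\<omega>. Y \<omega> \<bullet> b)"
      using indep_var_compose[OF ind, of "\<lambda>x. x \<bullet> b" borel "\<lambda>x. x \<bullet> b" borel] by (simp add: comp_def)
    show ?thesis
      using indep_var_integrable[OF i] indep_var_lebesgue_integral[OF i] int mean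
      by simp
  qed
  show "integrable M (\<lambda>\<omega>. X \<omega> \<bullet> Y \<omega>)"
    by (subst euclidean_inner) (use * in auto)
  show "expectation (\<lambda>\<omega>. X \<omega> \<bullet> Y \<omega>) = 0"
    by (subst euclidean_inner, subst Bochner_Integration.integral_sum) (use * in auto)
qed

text \<open>The squared deviation is a double sum of inner products of centred terms. Independence
  kills the off-diagonal ones, leaving \<open>card I\<close> diagonal terms divided by
  \<open>(card I)\<^sup>2\<close>.\<close>

lemma (in prob_space) iid_sample_mean:
  fixes g :: "'s \<Rightarrow> 'b::euclidean_space"
  assumes ind: "indep_vars (\<lambda>_. N) Y I" and I: "finite I" "I \<noteq> {}"
    and distr: "\<And>i. i \<in> I \<Longrightarrow> distr M N (Y i) = N"
    and g: "integrable N g" "integral\<^sup>L N g = f"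
    and var: "integrable N (\<lambda>s. (norm (g s - f))\<^sup>2)" "integral\<^sup>L N (\<lambda>s. (norm (g s - f))\<^sup>2) \<le> v"
  defines "Z \<equiv> \<lambda>\<omega>. (1 / real (card I)) *\<^sub>R (\<Sum>i\<in>I. g (Y i \<omega>))"
  shows "integrable M Z" "expectation Z = f"
    "integrable M (\<lambda>\<omega>. (norm (Z \<omega> - f))\<^sup>2)" "expectation (\<lambda>\<omega>. (norm (Z \<omega> - f))\<^sup>2) \<le> v / card I"
proof -
  define n where "n = real (card I)"
  have n: "n > 0" using I by (simp add: n_def card_gt_0_iff)
  have Y [measurable]: "Y i \<in> measurable M N" if "i \<in> I" for i
    using ind that by (auto simp: indep_vars_def)
  have gm [measurable]: "g \<in> borel_measurable N" using g(1) by (rule borel_measurable_integrable)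
  have gi: "integrable M (\<lambda>\<omega>. g (Y i \<omega>))" "expectation (\<lambda>\<omega>. g (Y i \<omega>)) = f" if "i \<in> I" for i
    using g distr[OF that] integrable_distr_eq[OF Y[OF that], of g] integral_distr[OF Y[OF that], of g] gm
    by metis+
  have vi: "integrable M (\<lambda>\<omega>. (norm (g (Y i \<omega>) - f))\<^sup>2)"
    "expectation (\<lambda>\<omega>. (norm (g (Y i \<omega>) - f))\<^sup>2) \<le> v" if "i \<in> I" for i
    using var distr[OF that] integrable_distr_eq[OF Y[OF that], of "\<lambda>s. (norm (g s - f))\<^sup>2"]
      integral_distr[OF Y[OF that], of "\<lambda>s. (norm (g s - f))\<^sup>2"] by simp_all
  show "integrable M Z" unfolding Z_def using gi by auto
  show "expectation Z = f"
    unfolding Z_def using gi n by (simp add: Bochner_Integration.integral_sum n_def sum_constant_scaleR)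
  define h where "h i \<omega> = g (Y i \<omega>) - f" for i \<omega>
  have hi: "integrable M (h i)" "expectation (h i) = 0" if "i \<in> I" for i
    unfolding h_def using gi[OF that] by (auto simp: prob_space)
  have cross: "integrable M (\<lambda>\<omega>. h i \<omega> \<bullet> h j \<omega>) \<and> expectation (\<lambda>\<omega>. h i \<omega> \<bullet> h j \<omega>) \<le> (if i = j then v else 0)"
    if ij: "i \<in> I" "j \<in> I" for i j
  proof (cases "i = j")
    case True
    then show ?thesis using vi[OF ij(1)] by (simp add: h_def power2_norm_eq_inner)
  next
    case False
    have "indep_var (PiM {i} (\<lambda>_. N)) (\<lambda>\<omega>. \<lambda>k\<in>{i}. Y k \<omega>) (PiM {j} (\<lambda>_. N)) (\<lambda>\<omega>. \<lambda>k\<in>{j}. Y k \<omega>)"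
      by (rule indep_var_restrict[OF ind]) (use ij False in auto)
    from indep_var_compose[OF this, of "\<lambda>z. g (z i) - f" borel "\<lambda>z. g (z j) - f" borel]
    have "indep_var borel (h i) borel (h j)" by (simp add: comp_def h_def[abs_def])
    from indep_var_inner_zero_mean[OF this hi(1)[OF ij(1)] hi(1)[OF ij(2)] hi(2)[OF ij(1)]]
    show ?thesis using False by simp
  qed
  have Z: "(norm (Z \<omega> - f))\<^sup>2 = (\<Sum>i\<in>I. \<Sum>j\<in>I. h i \<omega> \<bullet> h j \<omega>) / n\<^sup>2" for \<omega>
  proof -
    have "(\<Sum>i\<in>I. h i \<omega>) = (\<Sum>i\<in>I. g (Y i \<omega>)) - n *\<^sub>R f"
      unfolding h_def by (simp add: sum_subtractf n_def sum_constant_scaleR)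
    then have "Z \<omega> - f = (1 / n) *\<^sub>R (\<Sum>i\<in>I. h i \<omega>)"
      using n by (simp add: Z_def n_def[symmetric] scaleR_diff_right)
    then have "(norm (Z \<omega> - f))\<^sup>2 = ((\<Sum>i\<in>I. h i \<omega>) \<bullet> (\<Sum>i\<in>I. h i \<omega>)) / n\<^sup>2"
      unfolding power2_norm_eq_inner by (simp add: power2_eq_square)
    then show ?thesis by (simp add: inner_sum_left inner_sum_right inner_commute)
  qed
  show "integrable M (\<lambda>\<omega>. (norm (Z \<omega> - f))\<^sup>2)"
    unfolding Z using cross by auto
  have "expectation (\<lambda>\<omega>. (norm (Z \<omega> - f))\<^sup>2) = (\<Sum>i\<in>I. \<Sum>j\<in>I. expectation (\<lambda>\<omega>. h i \<omega> \<bullet> h j \<omega>)) / n\<^sup>2"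
    unfolding Z using cross by (simp add: Bochner_Integration.integral_sum)
  also have "\<dots> \<le> (\<Sum>i\<in>I. \<Sum>j\<in>I. if i = j then v else 0) / n\<^sup>2"
    using cross by (intro divide_right_mono sum_mono) auto
  also have "\<dots> = v / n"
    using I n by (simp add: n_def power2_eq_square)
  finally show "expectation (\<lambda>\<omega>. (norm (Z \<omega> - f))\<^sup>2) \<le> v / card I" by (simp add: n_def)
qed

section \<open>One step of the method\<close>

text \<open>In use, \<open>f\<close> is the operator at the extrapolated point, \<open>f0\<close>
  the operator at \<open>x\<close>, and \<open>g\<close> the estimate of \<open>f0\<close>.
  Expanding the square leaves a term \<open>- \<gamma>\<^sup>2 * (norm g)\<^sup>2\<close>, which by
  \<open>small\<close> pays for the gap between \<open>f\<close> and \<open>f0\<close> and for using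
  monotonicity at the extrapolated point instead of \<open>x\<close>.\<close>

lemma extragradient_descent:
  fixes x xstar g f f0 :: "'a::real_inner"
  assumes \<gamma>: "0 < \<gamma>" and \<mu>: "0 \<le> \<mu>" and small: "2 * (\<gamma> * L)\<^sup>2 + 2 * (\<gamma> * \<mu>) \<le> 1"
    and mono: "f \<bullet> (x - \<gamma> *\<^sub>R g - xstar) \<ge> \<mu> * (norm (x - \<gamma> *\<^sub>R g - xstar))\<^sup>2"
    and lip: "norm (f - f0) \<le> L * (\<gamma> * norm g)"
  shows "(norm (x - xstar - \<gamma> *\<^sub>R f))\<^sup>2 \<le> (1 - \<gamma> * \<mu>) * (norm (x - xstar))\<^sup>2 + 2 * \<gamma>\<^sup>2 * (norm (f0 - g))\<^sup>2"
proof -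
  define a where "a = x - xstar"
  have a: "x - \<gamma> *\<^sub>R g - xstar = a - \<gamma> *\<^sub>R g" by (simp add: a_def)
  have sq: "(norm (u + v))\<^sup>2 \<le> 2 * (norm u)\<^sup>2 + 2 * (norm v)\<^sup>2" for u v :: 'a
    using zero_le_power2[of "norm (u - v)"]
    by (simp add: power2_norm_eq_inner algebra_simps inner_commute)
  have 1: "(norm (a - \<gamma> *\<^sub>R f))\<^sup>2 = (norm a)\<^sup>2 - 2 * \<gamma> * (f \<bullet> (a - \<gamma> *\<^sub>R g))
      + \<gamma>\<^sup>2 * (norm (f - g))\<^sup>2 - \<gamma>\<^sup>2 * (norm g)\<^sup>2"
    unfolding power2_norm_eq_inner by (simp add: algebra_simps inner_commute power2_eq_square)
  have 2: "2 * \<gamma> * (\<mu> * (norm (a - \<gamma> *\<^sub>R g))\<^sup>2) \<le> 2 * \<gamma> * (f \<bullet> (a - \<gamma> *\<^sub>R g))"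
    using mono \<gamma> by (simp add: a)
  have "(norm a)\<^sup>2 \<le> 2 * (norm (a - \<gamma> *\<^sub>R g))\<^sup>2 + 2 * (norm (\<gamma> *\<^sub>R g))\<^sup>2"
    using sq[of "a - \<gamma> *\<^sub>R g" "\<gamma> *\<^sub>R g"] by simp
  then have "\<gamma> * \<mu> * (norm a)\<^sup>2 \<le> \<gamma> * \<mu> * (2 * (norm (a - \<gamma> *\<^sub>R g))\<^sup>2 + 2 * (norm (\<gamma> *\<^sub>R g))\<^sup>2)"
    using \<gamma> \<mu> by (intro mult_left_mono) auto
  then have 3: "\<gamma> * \<mu> * (norm a)\<^sup>2 \<le> 2 * \<gamma> * (\<mu> * (norm (a - \<gamma> *\<^sub>R g))\<^sup>2) + 2 * (\<gamma> * \<mu>) * (\<gamma>\<^sup>2 * (norm g)\<^sup>2)"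
    by (simp add: power_mult_distrib algebra_simps)
  have "(norm (f - f0))\<^sup>2 \<le> (L * (\<gamma> * norm g))\<^sup>2"
    using lip by (intro power_mono) auto
  then have "(norm (f - g))\<^sup>2 \<le> 2 * (L * (\<gamma> * norm g))\<^sup>2 + 2 * (norm (f0 - g))\<^sup>2"
    using sq[of "f - f0" "f0 - g"] by simp
  then have "\<gamma>\<^sup>2 * (norm (f - g))\<^sup>2 \<le> \<gamma>\<^sup>2 * (2 * (L * (\<gamma> * norm g))\<^sup>2 + 2 * (norm (f0 - g))\<^sup>2)"
    by (intro mult_left_mono) auto
  then have 4: "\<gamma>\<^sup>2 * (norm (f - g))\<^sup>2 \<le> 2 * (\<gamma> * L)\<^sup>2 * (\<gamma>\<^sup>2 * (norm g)\<^sup>2) + 2 * \<gamma>\<^sup>2 * (norm (f0 - g))\<^sup>2"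
    by (simp add: power_mult_distrib algebra_simps)
  have "(2 * (\<gamma> * L)\<^sup>2 + 2 * (\<gamma> * \<mu>)) * (\<gamma>\<^sup>2 * (norm g)\<^sup>2) \<le> 1 * (\<gamma>\<^sup>2 * (norm g)\<^sup>2)"
    using small by (intro mult_right_mono) auto
  then have 5: "2 * (\<gamma> * L)\<^sup>2 * (\<gamma>\<^sup>2 * (norm g)\<^sup>2) + 2 * (\<gamma> * \<mu>) * (\<gamma>\<^sup>2 * (norm g)\<^sup>2) \<le> \<gamma>\<^sup>2 * (norm g)\<^sup>2"
    by (simp add: algebra_simps)
  have "(norm (a - \<gamma> *\<^sub>R f))\<^sup>2 \<le> (norm a)\<^sup>2 - \<gamma> * \<mu> * (norm a)\<^sup>2 + 2 * \<gamma>\<^sup>2 * (norm (f0 - g))\<^sup>2"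
    using 1 2 3 4 5 by linarith
  then show ?thesis by (simp add: a_def algebra_simps)
qed

text \<open>One iteration from inside the good region: \<open>\<rho>\<close> is the current radius,
  \<open>E\<close> the contraction factor of its square, \<open>l\<close> the clipping level. The
  linear term contains the unclipped \<open>Y\<close>, so that it vanishes on average; the clipping
  bias is moved into the squared terms.\<close>

lemma clipped_step_exp_bound:
  fixes x xstar g Y :: "'a::real_inner" and F :: "'a \<Rightarrow> 'a"
  assumes \<gamma>: "0 < \<gamma>" and A: "1 \<le> A" and LA: "\<gamma> * L * A \<le> 1 / 650" and \<mu>: "0 \<le> \<mu>" "\<mu> \<le> L"
    and \<rho>: "0 < \<rho>" "\<rho> \<le> R"
    and sol: "F xstar = 0"
    and Lip: "\<And>x y. x \<in> cball xstar (3 * R) \<Longrightarrow> y \<in> cball xstar (3 * R) \<Longrightarrow>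
           norm (F x - F y) \<le> L * norm (x - y)"
    and mono: "\<And>x. x \<in> cball xstar (3 * R) \<Longrightarrow> F x \<bullet> (x - xstar) \<ge> \<mu> * (norm (x - xstar))\<^sup>2"
    and x: "(norm (x - xstar))\<^sup>2 \<le> 2 * \<rho>\<^sup>2"
  defines "E \<equiv> exp (- (\<gamma> * \<mu>))"
  defines "l \<equiv> E * \<rho> / (120 * \<gamma> * A)"
  assumes g: "norm g \<le> l"
  defines "xt \<equiv> x - \<gamma> *\<^sub>R g"
  defines "\<eta> \<equiv> x - xstar - \<gamma> *\<^sub>R F xt"
  defines "\<kappa> \<equiv> \<gamma>\<^sup>2 * A\<^sup>2 / \<rho>\<^sup>2"
  shows "xt \<in> cball xstar (3 * R)" "norm (F x) \<le> l"
    "exp (2 * A / \<rho>\<^sup>2 * ((norm (x - \<gamma> *\<^sub>R clip Y l - xstar))\<^sup>2 / E))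
      \<le> exp (2 * A / \<rho>\<^sup>2 * (norm (x - xstar))\<^sup>2) *
        (1 + 4 * A * \<gamma> / (E * \<rho>\<^sup>2) * ((F xt - Y) \<bullet> \<eta>) + 500 * \<kappa> * (norm (Y - F xt))\<^sup>2
          + 16 * \<kappa> * (norm (g - F x))\<^sup>2)"
proof -
  have L: "0 \<le> L" using \<mu> by simp
  have "\<gamma> * L * 1 \<le> \<gamma> * L * A" using A L \<gamma> by (intro mult_left_mono) auto
  then have \<gamma>L: "\<gamma> * L \<le> 1 / 650" using LA by simp
  have "\<gamma> * \<mu> \<le> \<gamma> * L" using \<gamma> \<mu> by simp
  then have \<gamma>\<mu>: "0 \<le> \<gamma> * \<mu>" "\<gamma> * \<mu> \<le> 1 / 650" using \<gamma>L \<gamma> \<mu> by (simp, linarith)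
  have E: "1 - \<gamma> * \<mu> \<le> E" "(99/100) \<le> E" "E \<le> 1" "0 < E"
    using exp_ge_add_one_self[of "- (\<gamma> * \<mu>)"] \<gamma>\<mu> by (auto simp: E_def)
  have l: "0 < l" using E \<rho> \<gamma> A by (simp add: l_def)
  have \<gamma>l: "\<gamma> * l = E * \<rho> / (120 * A)" using \<gamma> A by (simp add: l_def field_simps)
  have \<gamma>l': "\<gamma> * l \<le> \<rho> / 120"
  proof -
    have "E * \<rho> \<le> 1 * \<rho>" using E \<rho> by (intro mult_right_mono) auto
    also have "\<dots> \<le> \<rho> * A" using A \<rho> by simp
    finally show ?thesis unfolding \<gamma>l using A by (simp add: field_simps)
  qed
  \<comment> \<open>The number \<open>71/50\<close> is a rational bound for the square root of 2; an
    extrapolation step of length at most \<open>\<rho> / 120\<close> enlarges it to at most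
    \<open>143/100\<close>.\<close>
  have x1: "norm (x - xstar) \<le> (71/50) * \<rho>"
  proof (rule power2_le_imp_le)
    have "((71/50) * \<rho>)\<^sup>2 = (5041/2500) * \<rho>\<^sup>2" by (simp add: power2_eq_square)
    moreover have "0 \<le> \<rho>\<^sup>2" by simp
    ultimately show "(norm (x - xstar))\<^sup>2 \<le> ((71/50) * \<rho>)\<^sup>2" using x by linarith
  qed (use \<rho> in auto)
  have \<gamma>g: "\<gamma> * norm g \<le> \<gamma> * l" using g \<gamma> by simp
  have "norm (xt - xstar) \<le> norm (x - xstar) + norm (\<gamma> *\<^sub>R g)"
    unfolding xt_def using norm_triangle_ineq4[of "x - xstar" "\<gamma> *\<^sub>R g"] by (simp add: algebra_simps)
  then have xt1: "norm (xt - xstar) \<le> (143/100) * \<rho>" using x1 \<gamma>g \<gamma>l' \<gamma> \<rho> by (simp only: norm_scaleR abs_of_pos)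
  have xQ: "x \<in> cball xstar (3 * R)" and xtQ: "xt \<in> cball xstar (3 * R)" and sQ: "xstar \<in> cball xstar (3 * R)"
    using x1 xt1 \<rho> by (simp_all add: dist_norm norm_minus_commute)
  show "xt \<in> cball xstar (3 * R)" by (fact xtQ)
  \<comment> \<open>The bound is half the level because \<open>clip_bias\<close> requires it; the
    constant 650 against 120 leaves room for this.\<close>
  have F_le: "norm (F y) \<le> l / 2" if y: "y \<in> cball xstar (3 * R)" "norm (y - xstar) \<le> (143/100) * \<rho>" for y
  proof -
    have "norm (F y) \<le> L * norm (y - xstar)" using Lip[OF y(1) sQ] sol by simp
    also have "\<dots> \<le> L * ((143/100) * \<rho>)" using y L by (intro mult_left_mono) auto
    finally have "\<gamma> * A * norm (F y) \<le> \<gamma> * A * (L * ((143/100) * \<rho>))" using \<gamma> A by (intro mult_left_mono) auto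
    also have "\<dots> = (\<gamma> * L * A) * ((143/100) * \<rho>)" by simp
    also have "\<dots> \<le> 1 / 650 * ((143/100) * \<rho>)" using LA \<rho> by (intro mult_right_mono) auto
    also have "\<dots> \<le> (99/100) * \<rho> / 240" using \<rho> by simp
    also have "\<dots> \<le> E * \<rho> / 240" using E \<rho> by (intro divide_right_mono mult_right_mono) auto
    finally show ?thesis using \<gamma> A by (simp add: l_def field_simps)
  qed
  have Fx: "norm (F x) \<le> l / 2" using F_le[OF xQ] x1 \<rho> by simp
  have Fxt: "norm (F xt) \<le> l / 2" using F_le[OF xtQ] xt1 by simp
  show "norm (F x) \<le> l" using Fx l by simp
  \<comment> \<open>\<open>\<theta>\<close> is the error of the clipped update estimate and
    \<open>\<omega>\<close> that of the extrapolation estimate; each is at most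
    \<open>l / 2 + l\<close>.\<close>
  define \<theta> where "\<theta> = F xt - clip Y l"
  define \<omega> where "\<omega> = F x - g"
  have clip_l: "norm (clip Y l) \<le> l" using l by (rule norm_clip_le)
  have \<theta>: "norm \<theta> \<le> (3/2) * l"
    using norm_triangle_ineq4[of "F xt" "clip Y l"] Fxt clip_l by (simp add: \<theta>_def)
  have \<omega>: "norm \<omega> \<le> (3/2) * l"
    using norm_triangle_ineq4[of "F x" "g"] Fx g by (simp add: \<omega>_def)
  have B: "\<gamma> * norm u \<le> E * \<rho> / (80 * A)" if "norm u \<le> (3/2) * l" for u :: 'a
  proof -
    have "\<gamma> * norm u \<le> \<gamma> * ((3/2) * l)" using that \<gamma> by simp
    also have "\<dots> = 3/2 * (\<gamma> * l)" by simp
    also have "\<dots> = E * \<rho> / (80 * A)" unfolding \<gamma>l using A by simp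
    finally show ?thesis .
  qed
  have B2: "\<gamma>\<^sup>2 * (norm u)\<^sup>2 \<le> E\<^sup>2 * \<rho>\<^sup>2 / (6400 * A\<^sup>2)" if "norm u \<le> (3/2) * l" for u :: 'a
  proof -
    have "(\<gamma> * norm u)\<^sup>2 \<le> (E * \<rho> / (80 * A))\<^sup>2" using B[OF that] \<gamma> by (intro power_mono) auto
    then show ?thesis by (simp add: power_mult_distrib power_divide)
  qed
  have E2: "E\<^sup>2 \<le> E" using E by (simp add: power2_eq_square mult_left_le)
  have A2: "A \<le> A\<^sup>2" using A by (simp add: power2_eq_square)
  have B3: "\<gamma>\<^sup>2 * (norm u)\<^sup>2 \<le> \<rho>\<^sup>2 / 6400" if "norm u \<le> (3/2) * l" for u :: 'a
  proof -
    have "E\<^sup>2 * \<rho>\<^sup>2 / (6400 * A\<^sup>2) \<le> 1 * \<rho>\<^sup>2 / (6400 * 1)"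
      using E A E2 A2 by (intro frac_le mult_right_mono) auto
    from order_trans[OF B2[OF that] this] show ?thesis by simp
  qed
  have "(norm (x - xstar - \<gamma> *\<^sub>R F xt))\<^sup>2 \<le> (1 - \<gamma> * \<mu>) * (norm (x - xstar))\<^sup>2 + 2 * \<gamma>\<^sup>2 * (norm (F x - g))\<^sup>2"
  proof (rule extragradient_descent[OF \<gamma> \<mu>(1)])
    have "(\<gamma> * L)\<^sup>2 \<le> (1 / 650)\<^sup>2" using \<gamma>L \<gamma> L by (intro power_mono) auto
    then show "2 * (\<gamma> * L)\<^sup>2 + 2 * (\<gamma> * \<mu>) \<le> 1" using \<gamma>\<mu> by (simp add: power2_eq_square)
    show "\<mu> * (norm (x - \<gamma> *\<^sub>R g - xstar))\<^sup>2 \<le> F xt \<bullet> (x - \<gamma> *\<^sub>R g - xstar)"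
      using mono[OF xtQ] by (simp add: xt_def)
    show "norm (F xt - F x) \<le> L * (\<gamma> * norm g)"
      using Lip[OF xtQ xQ] \<gamma> by (simp add: xt_def)
  qed
  then have \<eta>1: "(norm \<eta>)\<^sup>2 \<le> (1 - \<gamma> * \<mu>) * (norm (x - xstar))\<^sup>2 + 2 * \<gamma>\<^sup>2 * (norm \<omega>)\<^sup>2"
    by (simp add: \<eta>_def \<omega>_def)
  have \<eta>: "norm \<eta> \<le> (3/2) * \<rho>"
  proof (rule power2_le_imp_le)
    have "(1 - \<gamma> * \<mu>) * (norm (x - xstar))\<^sup>2 \<le> 1 * (norm (x - xstar))\<^sup>2"
      using \<gamma>\<mu> by (intro mult_right_mono) auto
    then have "(norm \<eta>)\<^sup>2 \<le> 2 * \<rho>\<^sup>2 + 2 * (\<rho>\<^sup>2 / 6400)" using \<eta>1 x B3[OF \<omega>] by linarith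
    moreover have "((3/2) * \<rho>)\<^sup>2 = (9/4) * \<rho>\<^sup>2" by (simp add: power2_eq_square)
    moreover have "0 \<le> \<rho>\<^sup>2" by simp
    ultimately show "(norm \<eta>)\<^sup>2 \<le> ((3/2) * \<rho>)\<^sup>2" by linarith
  qed (use \<rho> in auto)
  \<comment> \<open>\<open>c\<close> multiplies the new squared distance in the exponent, and
    \<open>P + t\<close> bounds the growth of the exponent: \<open>P\<close> is linear in
    \<open>\<theta>\<close>, \<open>t\<close> collects the squares. The factor \<open>1 / A\<close>
    in the clipping level keeps both below \<open>1/2\<close>.\<close>
  define c where "c = 2 * A / (E * \<rho>\<^sup>2)"
  have c: "0 < c" using A E \<rho> by (simp add: c_def)
  define P where "P = 2 * c * \<gamma> * (\<theta> \<bullet> \<eta>)"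
  define t where "t = c * (2 * (\<gamma>\<^sup>2 * (norm \<omega>)\<^sup>2) + \<gamma>\<^sup>2 * (norm \<theta>)\<^sup>2)"
  have \<theta>\<eta>: "\<bar>\<theta> \<bullet> \<eta>\<bar> \<le> norm \<theta> * ((3/2) * \<rho>)"
    using Cauchy_Schwarz_ineq2[of \<theta> \<eta>] mult_left_mono[OF \<eta>, of "norm \<theta>"] by simp
  have "\<bar>P\<bar> = 2 * c * (\<gamma> * \<bar>\<theta> \<bullet> \<eta>\<bar>)" using c \<gamma> by (simp add: P_def abs_mult)
  also have "\<dots> \<le> 2 * c * (\<gamma> * (norm \<theta> * ((3/2) * \<rho>)))"
    using c \<gamma> \<theta>\<eta> by (intro mult_left_mono) auto
  also have "\<dots> = 2 * c * ((3/2) * \<rho>) * (\<gamma> * norm \<theta>)" by simp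
  also have "\<dots> \<le> 2 * c * ((3/2) * \<rho>) * (E * \<rho> / (80 * A))"
    using c \<rho> B[OF \<theta>] by (intro mult_left_mono) auto
  also have "\<dots> = 6 / 80" using E \<rho> A by (simp add: c_def power2_eq_square)
  finally have P: "\<bar>P\<bar> \<le> 1 / 2" by simp
  have t0: "0 \<le> t" using c by (simp add: t_def)
  have "t \<le> c * (3 * (E\<^sup>2 * \<rho>\<^sup>2 / (6400 * A\<^sup>2)))"
    unfolding t_def using c B2[OF \<theta>] B2[OF \<omega>] by (intro mult_left_mono) auto
  also have "\<dots> = 6 * E / (6400 * A)" using E \<rho> A by (simp add: c_def power2_eq_square field_simps)
  also have "\<dots> \<le> 6 * 1 / (6400 * 1)" using E A by (intro frac_le) auto
  finally have t: "t \<le> 1 / 2" by simp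
  have "x - \<gamma> *\<^sub>R clip Y l - xstar = \<eta> + \<gamma> *\<^sub>R \<theta>"
    by (simp add: \<eta>_def \<theta>_def algebra_simps)
  then have "(norm (x - \<gamma> *\<^sub>R clip Y l - xstar))\<^sup>2 = (norm \<eta>)\<^sup>2 + 2 * \<gamma> * (\<theta> \<bullet> \<eta>) + \<gamma>\<^sup>2 * (norm \<theta>)\<^sup>2"
    unfolding power2_norm_eq_inner by (simp add: algebra_simps inner_commute power2_eq_square)
  also have "\<dots> \<le> (1 - \<gamma> * \<mu>) * (norm (x - xstar))\<^sup>2 + 2 * \<gamma>\<^sup>2 * (norm \<omega>)\<^sup>2 + 2 * \<gamma> * (\<theta> \<bullet> \<eta>) + \<gamma>\<^sup>2 * (norm \<theta>)\<^sup>2"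
    using \<eta>1 by linarith
  also have "\<dots> \<le> E * (norm (x - xstar))\<^sup>2 + 2 * \<gamma>\<^sup>2 * (norm \<omega>)\<^sup>2 + 2 * \<gamma> * (\<theta> \<bullet> \<eta>) + \<gamma>\<^sup>2 * (norm \<theta>)\<^sup>2"
    using mult_right_mono[OF E(1), of "(norm (x - xstar))\<^sup>2"] by simp
  finally have "c * (norm (x - \<gamma> *\<^sub>R clip Y l - xstar))\<^sup>2 \<le> c * \<dots>"
    using c by (intro mult_left_mono) auto
  also have "\<dots> = c * E * (norm (x - xstar))\<^sup>2 + (P + t)"
    by (simp add: P_def t_def algebra_simps)
  finally have main: "2 * A / \<rho>\<^sup>2 * ((norm (x - \<gamma> *\<^sub>R clip Y l - xstar))\<^sup>2 / E)
      \<le> 2 * A / \<rho>\<^sup>2 * (norm (x - xstar))\<^sup>2 + (P + t)"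
    using E by (simp add: c_def mult_ac)
  have E_inv: "1 / E \<le> (51/50)" "1 / E\<^sup>2 \<le> (103/100)"
  proof -
    have "(99/100)\<^sup>2 \<le> E\<^sup>2" using E by (intro power_mono) auto
    then have "9801/10000 \<le> E\<^sup>2" by (simp add: power2_eq_square)
    then show "1 / E \<le> (51/50)" "1 / E\<^sup>2 \<le> (103/100)" using E by (auto simp: field_simps)
  qed
  have \<kappa>: "0 \<le> \<kappa>" by (simp add: \<kappa>_def)
  have c\<gamma>: "c * \<gamma>\<^sup>2 \<le> (51/25) * \<kappa>"
  proof -
    have "c * \<gamma>\<^sup>2 = 2 * (1 / E) * (\<gamma>\<^sup>2 * A / \<rho>\<^sup>2)" by (simp add: c_def)
    also have "\<dots> \<le> 2 * (51/50) * (\<gamma>\<^sup>2 * A\<^sup>2 / \<rho>\<^sup>2)"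
      using E E_inv A A2 by (intro mult_mono divide_right_mono) auto
    finally show ?thesis by (simp add: \<kappa>_def)
  qed
  have clip_near: "norm \<theta> \<le> norm (Y - F xt)"
    using clip_nonexpansive[OF l, of "F xt" Y] Fxt l by (simp add: \<theta>_def norm_minus_commute)
  then have \<theta>Y: "(norm \<theta>)\<^sup>2 \<le> (norm (Y - F xt))\<^sup>2" by (intro power_mono) auto
  have "P\<^sup>2 = 4 * c\<^sup>2 * \<gamma>\<^sup>2 * \<bar>\<theta> \<bullet> \<eta>\<bar>\<^sup>2" by (simp add: P_def power_mult_distrib)
  also have "\<dots> \<le> 4 * c\<^sup>2 * \<gamma>\<^sup>2 * (norm \<theta> * ((3/2) * \<rho>))\<^sup>2"
    using \<theta>\<eta> by (intro mult_left_mono power_mono) auto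
  also have "\<dots> = 36 * (1 / E\<^sup>2) * \<kappa> * (norm \<theta>)\<^sup>2"
    using E \<rho> by (simp add: c_def \<kappa>_def power_mult_distrib power_divide field_simps power2_eq_square)
  also have "\<dots> \<le> 36 * (103/100) * \<kappa> * (norm (Y - F xt))\<^sup>2"
    using E_inv \<kappa> \<theta>Y by (intro mult_mono mult_nonneg_nonneg) auto
  finally have P2: "P\<^sup>2 \<le> 38 * \<kappa> * (norm (Y - F xt))\<^sup>2"
    using mult_nonneg_nonneg[OF \<kappa> zero_le_power2[of "norm (Y - F xt)"]] by (simp only: mult.assoc)
  have t2: "t \<le> (51/25) * \<kappa> * (2 * (norm \<omega>)\<^sup>2 + (norm (Y - F xt))\<^sup>2)"
  proof -
    have "t = (c * \<gamma>\<^sup>2) * (2 * (norm \<omega>)\<^sup>2 + (norm \<theta>)\<^sup>2)" by (simp add: t_def algebra_simps)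
    also have "\<dots> \<le> (51/25) * \<kappa> * (2 * (norm \<omega>)\<^sup>2 + (norm (Y - F xt))\<^sup>2)"
      using c\<gamma> \<theta>Y \<kappa> by (intro mult_mono[OF c\<gamma>]) auto
    finally show ?thesis .
  qed
  \<comment> \<open>\<open>clip Y l\<close> is exchanged for \<open>Y\<close> at the cost of the
    bias. The factor 360 comes from \<open>2 * c * \<gamma> * ((3/2) * \<rho>) / (2 * l)\<close>,
    and 371 rounds up \<open>360 * (103/100)\<close>.\<close>
  have P1: "P \<le> 2 * c * \<gamma> * ((F xt - Y) \<bullet> \<eta>) + 371 * \<kappa> * (norm (Y - F xt))\<^sup>2"
  proof -
    have "\<theta> \<bullet> \<eta> = (F xt - Y) \<bullet> \<eta> + (Y - clip Y l) \<bullet> \<eta>" by (simp add: \<theta>_def algebra_simps)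
    moreover have "(Y - clip Y l) \<bullet> \<eta> \<le> (norm (Y - F xt))\<^sup>2 / (2 * l) * ((3/2) * \<rho>)"
    proof -
      have "(Y - clip Y l) \<bullet> \<eta> \<le> norm (Y - clip Y l) * norm \<eta>" by (rule norm_cauchy_schwarz)
      also have "\<dots> \<le> (norm (Y - F xt))\<^sup>2 / (2 * l) * ((3/2) * \<rho>)"
        using clip_bias[OF l Fxt, of Y] \<eta> l by (intro mult_mono) auto
      finally show ?thesis .
    qed
    ultimately have "P \<le> 2 * c * \<gamma> * ((F xt - Y) \<bullet> \<eta> + (norm (Y - F xt))\<^sup>2 / (2 * l) * ((3/2) * \<rho>))"
      unfolding P_def using c \<gamma> by (intro mult_left_mono) auto
    also have "\<dots> = 2 * c * \<gamma> * ((F xt - Y) \<bullet> \<eta>) + 360 * (1 / E\<^sup>2) * \<kappa> * (norm (Y - F xt))\<^sup>2"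
      using E \<rho> A \<gamma> by (simp add: c_def l_def \<kappa>_def distrib_left power2_eq_square mult_ac)
    also have "360 * (1 / E\<^sup>2) * \<kappa> * (norm (Y - F xt))\<^sup>2 \<le> 360 * (103/100) * \<kappa> * (norm (Y - F xt))\<^sup>2"
      using E_inv \<kappa> by (intro mult_mono mult_nonneg_nonneg) auto
    finally have "P \<le> 2 * c * \<gamma> * ((F xt - Y) \<bullet> \<eta>) + 360 * (103/100) * \<kappa> * (norm (Y - F xt))\<^sup>2"
      by simp
    then show ?thesis
      using mult_nonneg_nonneg[OF \<kappa> zero_le_power2[of "norm (Y - F xt)"]] by (simp only: mult.assoc)
  qed
  \<comment> \<open>The coefficients add up to \<open>371 + 2 * 38 + 2 * (51/25) < 500\<close> for
    the update noise and \<open>4 * (51/25) < 16\<close> for the extrapolation noise.\<close>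
  have "exp (P + t) \<le> 1 + P + 2 * P\<^sup>2 + 2 * t" by (rule exp_add_le[OF P t0 t])
  also have "\<dots> \<le> 1 + 2 * c * \<gamma> * ((F xt - Y) \<bullet> \<eta>) + 371 * (\<kappa> * (norm (Y - F xt))\<^sup>2)
      + 2 * (38 * (\<kappa> * (norm (Y - F xt))\<^sup>2)) + 2 * ((51/25) * (2 * (\<kappa> * (norm \<omega>)\<^sup>2) + \<kappa> * (norm (Y - F xt))\<^sup>2))"
    using P1 P2 t2 by (simp add: algebra_simps)
  also have "\<dots> \<le> 1 + 2 * c * \<gamma> * ((F xt - Y) \<bullet> \<eta>) + 500 * (\<kappa> * (norm (Y - F xt))\<^sup>2) + 16 * (\<kappa> * (norm \<omega>)\<^sup>2)"
    using mult_nonneg_nonneg[OF \<kappa> zero_le_power2[of "norm (Y - F xt)"]]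
      mult_nonneg_nonneg[OF \<kappa> zero_le_power2[of "norm \<omega>"]] by (simp add: field_simps)
  finally have ex: "exp (P + t) \<le> 1 + 4 * A * \<gamma> / (E * \<rho>\<^sup>2) * ((F xt - Y) \<bullet> \<eta>)
      + 500 * \<kappa> * (norm (Y - F xt))\<^sup>2 + 16 * \<kappa> * (norm (g - F x))\<^sup>2"
    by (simp add: c_def \<omega>_def norm_minus_commute mult_ac)
  have "exp (2 * A / \<rho>\<^sup>2 * ((norm (x - \<gamma> *\<^sub>R clip Y l - xstar))\<^sup>2 / E))
      \<le> exp (2 * A / \<rho>\<^sup>2 * (norm (x - xstar))\<^sup>2) * exp (P + t)"
    using main by (simp add: exp_add[symmetric])
  also have "\<dots> \<le> exp (2 * A / \<rho>\<^sup>2 * (norm (x - xstar))\<^sup>2) * (1 + 4 * A * \<gamma> / (E * \<rho>\<^sup>2) * ((F xt - Y) \<bullet> \<eta>)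
      + 500 * \<kappa> * (norm (Y - F xt))\<^sup>2 + 16 * \<kappa> * (norm (g - F x))\<^sup>2)"
    using ex by (intro mult_left_mono) auto
  finally show "exp (2 * A / \<rho>\<^sup>2 * ((norm (x - \<gamma> *\<^sub>R clip Y l - xstar))\<^sup>2 / E))
      \<le> exp (2 * A / \<rho>\<^sup>2 * (norm (x - xstar))\<^sup>2) *
        (1 + 4 * A * \<gamma> / (E * \<rho>\<^sup>2) * ((F xt - Y) \<bullet> \<eta>) + 500 * \<kappa> * (norm (Y - F xt))\<^sup>2
          + 16 * \<kappa> * (norm (g - F x))\<^sup>2)" .
qed

section \<open>The iterates as functions of the samples\<close>

lemma measurable_clip [measurable]:
  "(\<lambda>y::'a::euclidean_space. clip y l) \<in> borel_measurable borel"
  unfolding clip_def by measurable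

lemma measurable_clipped_batch:
  fixes G :: "'s \<Rightarrow> 'a::euclidean_space \<Rightarrow> 'a"
  assumes G: "(\<lambda>(s, x). G s x) \<in> borel_measurable (D \<Otimes>\<^sub>M borel)"
    and x [measurable]: "x \<in> borel_measurable N"
    and \<zeta>: "\<And>i. i \<in> {1..n} \<Longrightarrow> (\<lambda>z. \<zeta> z i) \<in> measurable N D"
  shows "(\<lambda>z. clipped_batch G n l (\<zeta> z) (x z)) \<in> borel_measurable N"
proof -
  have "(\<lambda>z. G (\<zeta> z i) (x z)) \<in> borel_measurable N" if "i \<in> {1..n}" for i
    using measurable_compose[OF measurable_Pair[OF \<zeta>[OF that] x] G] by simp
  then have [measurable]: "(\<lambda>z. \<Sum>i = 1..n. G (\<zeta> z i) (x z)) \<in> borel_measurable N"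
    by (rule borel_measurable_sum)
  show ?thesis unfolding clipped_batch_def by measurable
qed

lemma clipped_batch_cong:
  "(\<And>i. i \<in> {1..n} \<Longrightarrow> \<zeta> i = \<zeta>' i) \<Longrightarrow> clipped_batch G n l \<zeta> x = clipped_batch G n l \<zeta>' x"
  unfolding clipped_batch_def by (metis (mono_tags, lifting) sum.cong)

text \<open>The sampling model alone, without the operator and its properties; adaptedness and
  independence are settled at this level.\<close>

locale clipped_SEG_samples = M: prob_space M + D: prob_space D
  for M :: "'w measure" and D :: "'s measure" +
  fixes G :: "'s \<Rightarrow> 'a::euclidean_space \<Rightarrow> 'a"
    and \<xi> :: "nat \<Rightarrow> nat \<Rightarrow> nat \<Rightarrow> 'w \<Rightarrow> 's"
    and x0 :: 'a and \<gamma> :: real and lam :: "nat \<Rightarrow> real" and m :: "nat \<Rightarrow> nat" and K :: nat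
  assumes oracle_measurable: "(\<lambda>(s, x). G s x) \<in> borel_measurable (D \<Otimes>\<^sub>M borel)"
    and samples_indep: "M.indep_vars (\<lambda>_. D) (\<lambda>(j, i, k). \<xi> j i k)
           {(j, i, k). j \<in> {1, 2} \<and> i \<in> {1..m k} \<and> k \<le> K}"
    and samples_distr: "\<And>j i k. j \<in> {1, 2} \<Longrightarrow> i \<in> {1..m k} \<Longrightarrow> k \<le> K \<Longrightarrow> distr M D (\<xi> j i k) = D"
    and m_pos: "\<And>k. k \<le> K \<Longrightarrow> 0 < m k"
begin

text \<open>A sample is addressed by \<open>(j, i, k)\<close>: number \<open>i\<close> of the batch for half-step \<open>j\<close> of iteration \<open>k\<close>.\<close>

definition past :: "nat \<Rightarrow> (nat \<times> nat \<times> nat) set" where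
  "past k = {(j, i, l). j \<in> {1, 2} \<and> i \<in> {1..m l} \<and> l < k}"

definition batch :: "nat \<Rightarrow> nat \<Rightarrow> (nat \<times> nat \<times> nat) set" where
  "batch j k = (\<lambda>i. (j, i, k)) ` {1..m k}"

definition samples :: "'w \<Rightarrow> nat \<times> nat \<times> nat \<Rightarrow> 's" where
  "samples \<omega> = (\<lambda>(j, i, k). \<xi> j i k \<omega>)"

text \<open>The argument is a whole sample family instead of an outcome: dependence on some of the
  samples becomes invariance under \<open>restrict\<close>, and independence of disjoint index sets
  carries over to the iterates.\<close>

definition iter :: "nat \<Rightarrow> (nat \<times> nat \<times> nat \<Rightarrow> 's) \<Rightarrow> 'a" where
  "iter k z = clipped_SEG G \<gamma> \<gamma> lam lam m m (\<lambda>i l. z (1, i, l)) (\<lambda>i l. z (2, i, l)) x0 k"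

definition grad :: "nat \<Rightarrow> nat \<Rightarrow> (nat \<times> nat \<times> nat \<Rightarrow> 's) \<Rightarrow> 'a \<Rightarrow> 'a" where
  "grad j k z x = clipped_batch G (m k) (lam k) (\<lambda>i. z (j, i, k)) x"

lemma iter_0: "iter 0 z = x0"
  by (simp add: iter_def)

lemma iter_Suc: "iter (Suc k) z = iter k z - \<gamma> *\<^sub>R grad 2 k z (iter k z - \<gamma> *\<^sub>R grad 1 k z (iter k z))"
  by (simp add: iter_def grad_def Let_def)

lemma grad_restrict: "batch j k \<subseteq> J \<Longrightarrow> grad j k (restrict z J) x = grad j k z x"
  unfolding grad_def batch_def by (intro clipped_batch_cong) (simp add: image_subset_iff)

lemma measurable_grad:
  assumes "batch j k \<subseteq> J" and x: "x \<in> borel_measurable N" and z: "z \<in> measurable N (PiM J (\<lambda>_. D))"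
  shows "(\<lambda>w. grad j k (z w) (x w)) \<in> borel_measurable N"
  unfolding grad_def
proof (rule measurable_clipped_batch[OF oracle_measurable x])
  fix i assume "i \<in> {1..m k}"
  then have "(j, i, k) \<in> J" using assms(1) by (auto simp: batch_def)
  then show "(\<lambda>w. z w (j, i, k)) \<in> measurable N D"
    by (rule measurable_compose[OF z measurable_component_singleton])
qed

lemma past_Suc: "past (Suc k) = past k \<union> batch 1 k \<union> batch 2 k"
  by (auto simp: past_def batch_def less_Suc_eq)

text \<open>Only batches of earlier iterations enter. Together with measurability on the product
  over \<open>J\<close>, this expresses adaptedness without a filtration.\<close>

lemma iter_restrict: "past k \<subseteq> J \<Longrightarrow> iter k (restrict z J) = iter k z"
  by (induction k) (simp_all add: iter_0 iter_Suc past_Suc grad_restrict)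

lemma measurable_iter: "past k \<subseteq> J \<Longrightarrow> iter k \<in> borel_measurable (PiM J (\<lambda>_. D))"
proof (induction k)
  case 0
  then show ?case by (simp add: iter_0[abs_def])
next
  case (Suc k)
  then have J: "batch 1 k \<subseteq> J" "batch 2 k \<subseteq> J" and [measurable]: "iter k \<in> borel_measurable (PiM J (\<lambda>_. D))"
    by (auto simp: past_Suc)
  have [measurable]: "(\<lambda>z. grad 1 k z (iter k z)) \<in> borel_measurable (PiM J (\<lambda>_. D))"
    by (rule measurable_grad[OF J(1)]; measurable)
  have [measurable]: "(\<lambda>z. grad 2 k z (iter k z - \<gamma> *\<^sub>R grad 1 k z (iter k z))) \<in> borel_measurable (PiM J (\<lambda>_. D))"
    by (rule measurable_grad[OF J(2)]; measurable)
  show ?case unfolding iter_Suc[abs_def] by measurable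
qed

lemma indep_samples: "M.indep_vars (\<lambda>_. D) (\<lambda>p \<omega>. samples \<omega> p) (past (Suc K))"
proof -
  have "(\<lambda>p \<omega>. samples \<omega> p) = (\<lambda>(j, i, k). \<xi> j i k)" by (auto simp: samples_def)
  moreover have "past (Suc K) = {(j, i, k). j \<in> {1, 2} \<and> i \<in> {1..m k} \<and> k \<le> K}"
    by (auto simp: past_def)
  ultimately show ?thesis using samples_indep by simp
qed

lemma measurable_samples:
  "J \<subseteq> past (Suc K) \<Longrightarrow> (\<lambda>\<omega>. restrict (samples \<omega>) J) \<in> measurable M (PiM J (\<lambda>_. D))"
  using indep_samples by (intro measurable_restrict) (auto simp: M.indep_vars_def)

lemma batch_subset: "j \<in> {1, 2} \<Longrightarrow> k \<le> K \<Longrightarrow> batch j k \<subseteq> past (Suc K)"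
  by (auto simp: batch_def past_def)

lemma past_mono: "k \<le> l \<Longrightarrow> past k \<subseteq> past l"
  by (auto simp: past_def)

lemma measurable_iter_samples:
  assumes "k \<le> Suc K"
  shows "(\<lambda>\<omega>. iter k (samples \<omega>)) \<in> borel_measurable M"
  using measurable_compose[OF measurable_samples[OF order_refl] measurable_iter[OF past_mono[OF assms]]]
  by (simp only: iter_restrict[OF past_mono[OF assms]])

text \<open>\<open>U\<close> is the state before the batch is drawn and \<open>y\<close> the point at which the operator is queried;
  the batch may be replaced by an independent copy.\<close>

lemma nn_integral_fresh_batch:
  fixes U :: "(nat \<times> nat \<times> nat \<Rightarrow> 's) \<Rightarrow> 'c::topological_space"
  assumes jk: "j \<in> {1, 2}" "k \<le> K" and A: "A \<subseteq> past (Suc K)" "A \<inter> batch j k = {}"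
    and U: "U \<in> borel_measurable (PiM A (\<lambda>_. D))" "\<And>z. U (restrict z A) = U z"
    and y [measurable]: "y \<in> borel_measurable borel"
    and \<psi>: "(\<lambda>(c, g). \<psi> c g) \<in> borel_measurable (borel \<Otimes>\<^sub>M borel)"
  shows "(\<integral>\<^sup>+ \<omega>. \<psi> (U (samples \<omega>)) (grad j k (samples \<omega>) (y (U (samples \<omega>)))) \<partial>M)
    = (\<integral>\<^sup>+ \<omega>. (\<integral>\<^sup>+ \<omega>'. \<psi> (U (samples \<omega>)) (grad j k (samples \<omega>') (y (U (samples \<omega>)))) \<partial>M) \<partial>M)"
proof -
  let ?B = "batch j k"
  have ind: "M.indep_var (PiM A (\<lambda>_. D)) (\<lambda>\<omega>. restrict (samples \<omega>) A) (PiM ?B (\<lambda>_. D)) (\<lambda>\<omega>. restrict (samples \<omega>) ?B)"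
    by (rule M.indep_var_restrict[OF indep_samples A(2) A(1) batch_subset[OF jk]])
  have [measurable]: "(\<lambda>w. U (fst w)) \<in> borel_measurable (PiM A (\<lambda>_. D) \<Otimes>\<^sub>M PiM ?B (\<lambda>_. D))"
    by (rule measurable_compose[OF measurable_fst U(1)])
  have "(\<lambda>w. grad j k (snd w) (y (U (fst w)))) \<in> borel_measurable (PiM A (\<lambda>_. D) \<Otimes>\<^sub>M PiM ?B (\<lambda>_. D))"
    by (rule measurable_grad[OF order_refl]; measurable)
  from measurable_compose[OF measurable_Pair[OF _ this] \<psi>]
  have "(\<lambda>(u, v). \<psi> (U u) (grad j k v (y (U u)))) \<in> borel_measurable (PiM A (\<lambda>_. D) \<Otimes>\<^sub>M PiM ?B (\<lambda>_. D))"
    by (simp add: case_prod_beta')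
  from M.nn_integral_indep_var[OF ind this] show ?thesis
    by (simp add: grad_restrict U(2))
qed

lemma grad_eq: "grad j k (samples \<omega>) x = clip ((1 / real (card (batch j k))) *\<^sub>R (\<Sum>p\<in>batch j k. G (samples \<omega> p) x)) (lam k)"
proof -
  have inj: "inj_on (\<lambda>i. (j, i, k)) {1..m k}" by (auto simp: inj_on_def)
  show ?thesis
    by (simp add: grad_def clipped_batch_def batch_def card_image[OF inj] sum.reindex[OF inj] del: One_nat_def)
qed

lemma card_batch: "card (batch j k) = m k"
  unfolding batch_def by (subst card_image) (auto simp: inj_on_def)

text \<open>The clipped estimate may be biased, so the unclipped average \<open>Y\<close> behind it
  is exposed: it has the right mean, and its variance is divided by the batch size.\<close>

lemma batch_mean:
  assumes jk: "j \<in> {1, 2}" "k \<le> K"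
    and int: "integrable D (\<lambda>s. G s x)" "integral\<^sup>L D (\<lambda>s. G s x) = f"
    and var: "integrable D (\<lambda>s. (norm (G s x - f))\<^sup>2)" "integral\<^sup>L D (\<lambda>s. (norm (G s x - f))\<^sup>2) \<le> v"
  obtains Y where "\<And>\<omega>. grad j k (samples \<omega>) x = clip (Y \<omega>) (lam k)"
    "integrable M Y" "M.expectation Y = f"
    "integrable M (\<lambda>\<omega>. (norm (Y \<omega> - f))\<^sup>2)" "M.expectation (\<lambda>\<omega>. (norm (Y \<omega> - f))\<^sup>2) \<le> v / m k"
proof -
  let ?Y = "\<lambda>\<omega>. (1 / real (card (batch j k))) *\<^sub>R (\<Sum>p\<in>batch j k. G (samples \<omega> p) x)"
  have ind: "M.indep_vars (\<lambda>_. D) (\<lambda>p \<omega>. samples \<omega> p) (batch j k)"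
    by (rule M.indep_vars_subset[OF indep_samples batch_subset[OF jk]])
  have fin: "finite (batch j k)" "batch j k \<noteq> {}"
    using m_pos[OF jk(2)] by (auto simp: batch_def)
  have distr: "distr M D (\<lambda>\<omega>. samples \<omega> p) = D" if "p \<in> batch j k" for p
    using that samples_distr jk by (auto simp: batch_def samples_def)
  show thesis
  proof (rule that[OF grad_eq])
    show "integrable M ?Y"
      by (rule M.iid_sample_mean(1)[OF ind fin _ int var]) (rule distr)
    show "M.expectation ?Y = f"
      by (rule M.iid_sample_mean(2)[OF ind fin _ int var]) (rule distr)
    show "integrable M (\<lambda>\<omega>. (norm (?Y \<omega> - f))\<^sup>2)"
      by (rule M.iid_sample_mean(3)[OF ind fin _ int var]) (rule distr)
    show "M.expectation (\<lambda>\<omega>. (norm (?Y \<omega> - f))\<^sup>2) \<le> v / m k"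
      unfolding card_batch[of j k, symmetric]
      by (rule M.iid_sample_mean(4)[OF ind fin _ int var]) (rule distr)
  qed
qed

end

section \<open>The exponential supermartingale\<close>

text \<open>The confidence level enters only through \<open>A\<close>, which is kept abstract. The
  inequality \<open>\<mu> \<le> L\<close> is assumed here and derived from monotonicity and
  Lipschitz continuity in the final theorem.\<close>

locale clipped_SEG_monotone = clipped_SEG_samples M D G \<xi> x0 \<gamma> lam m K
  for M :: "'w measure" and D :: "'s measure" and G :: "'s \<Rightarrow> 'a::euclidean_space \<Rightarrow> 'a"
    and \<xi> x0 \<gamma> lam m K +
  fixes F :: "'a \<Rightarrow> 'a" and xstar :: 'a and R \<sigma> L \<mu> A :: real
  assumes oracle_integrable: "\<And>x. integrable D (\<lambda>s. G s x)"
    and oracle_mean: "\<And>x. F x = D.expectation (\<lambda>s. G s x)"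
    and R: "0 < R" "norm (x0 - xstar) \<le> R"
    and variance: "\<And>x. x \<in> cball xstar (3 * R) \<Longrightarrow>
           integrable D (\<lambda>s. (norm (G s x - F x))\<^sup>2) \<and>
           D.expectation (\<lambda>s. (norm (G s x - F x))\<^sup>2) \<le> \<sigma>\<^sup>2"
    and Lipschitz: "\<And>x y. x \<in> cball xstar (3 * R) \<Longrightarrow> y \<in> cball xstar (3 * R) \<Longrightarrow>
           norm (F x - F y) \<le> L * norm (x - y)"
    and solution: "F xstar = 0"
    and \<mu>: "0 \<le> \<mu>" "\<mu> \<le> L"
    and monotone: "\<And>x. x \<in> cball xstar (3 * R) \<Longrightarrow> F x \<bullet> (x - xstar) \<ge> \<mu> * (norm (x - xstar))\<^sup>2"
    and A: "1 \<le> A"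
    and \<gamma>: "0 < \<gamma>" "\<gamma> * L * A \<le> 1 / 650"
    and lam: "\<And>k. k \<le> K \<Longrightarrow> lam k = exp (- \<gamma> * \<mu> * (1 + real k / 2)) * R / (120 * \<gamma> * A)"
    and m: "\<And>k. k \<le> K \<Longrightarrow> 264600 * \<gamma>\<^sup>2 * (real K + 1) * \<sigma>\<^sup>2 * A / (exp (- \<gamma> * \<mu> * real k) * R\<^sup>2) \<le> real (m k)"
begin

text \<open>The halved exponent makes the squared radius decay at the rate of the claim, which then
  bounds the squared distance by twice the squared radius.\<close>

definition radius :: "nat \<Rightarrow> real" where
  "radius k = exp (- \<gamma> * \<mu> * (real k / 2)) * R"

lemma radius_pos: "0 < radius k"
  using R by (simp add: radius_def)

lemma radius_le: "radius k \<le> R"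
proof -
  have "exp (- \<gamma> * \<mu> * (real k / 2)) * R \<le> 1 * R"
    using \<gamma> \<mu> R by (intro mult_right_mono) auto
  then show ?thesis by (simp add: radius_def)
qed

lemma radius_sq: "(radius k)\<^sup>2 = exp (- \<gamma> * \<mu> * real k) * R\<^sup>2"
  by (simp add: radius_def power_mult_distrib exp_double[symmetric] field_simps)

lemma radius_Suc_sq: "(radius (Suc k))\<^sup>2 = exp (- (\<gamma> * \<mu>)) * (radius k)\<^sup>2"
  unfolding radius_sq by (simp add: exp_add[symmetric] algebra_simps)

text \<open>The exponent \<open>1 + k / 2\<close> splits into one contraction factor and the radius,
  the form that \<open>clipped_step_exp_bound\<close> gives to its level.\<close>

lemma lam_eq: "k \<le> K \<Longrightarrow> lam k = exp (- (\<gamma> * \<mu>)) * radius k / (120 * \<gamma> * A)"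
  by (simp add: lam radius_def mult_exp_exp algebra_simps)

lemma lam_pos: "k \<le> K \<Longrightarrow> 0 < lam k"
  using radius_pos[of k] \<gamma> A by (simp add: lam_eq)

definition \<delta> :: real where "\<delta> = A / (real K + 1)"

text \<open>This is \<open>\<kappa>\<close> of \<open>clipped_step_exp_bound\<close> at the current
  radius.\<close>

definition noise_weight :: "nat \<Rightarrow> real" where
  "noise_weight k = \<gamma>\<^sup>2 * A\<^sup>2 / (radius k)\<^sup>2"

lemma \<delta>_pos: "0 < \<delta>"
  using A by (simp add: \<delta>_def)

lemma noise_weight_nonneg: "0 \<le> noise_weight k"
  by (simp add: noise_weight_def)

text \<open>The batch size serves this bound: \<open>516 = 500 + 16\<close> adds the two
  coefficients of squared noise, well below the 264600 available.\<close>

lemma noise_weight_variance: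
  assumes "k \<le> K"
  shows "516 * (noise_weight k * (\<sigma>\<^sup>2 / m k)) \<le> \<delta>"
proof -
  have mk: "0 < real (m k)" using m_pos[OF assms] by simp
  have "noise_weight k * \<sigma>\<^sup>2 * (264600 * (real K + 1))
      = A * (264600 * \<gamma>\<^sup>2 * (real K + 1) * \<sigma>\<^sup>2 * A / (radius k)\<^sup>2)"
    by (simp add: noise_weight_def power2_eq_square mult_ac)
  also have "\<dots> \<le> A * real (m k)"
    using m[OF assms] A by (intro mult_left_mono) (auto simp: radius_sq)
  finally have "noise_weight k * (\<sigma>\<^sup>2 / m k) * (264600 * (real K + 1)) \<le> A"
    using mk by (simp add: field_simps)
  then have "264600 * (noise_weight k * (\<sigma>\<^sup>2 / m k)) \<le> \<delta>"
    by (simp add: \<delta>_def field_simps)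
  moreover have "0 \<le> noise_weight k * (\<sigma>\<^sup>2 / m k)"
    using noise_weight_nonneg mk by simp
  ultimately show ?thesis by linarith
qed

text \<open>The shift by 2 gives the value 1 on the boundary of the good region, so that truncation
  at 1 matches failure.\<close>

definition energy :: "nat \<Rightarrow> 'a \<Rightarrow> real" where
  "energy k x = exp (2 * A * ((norm (x - xstar))\<^sup>2 / (radius k)\<^sup>2 - 2))"

definition good :: "nat \<Rightarrow> 'a \<Rightarrow> bool" where
  "good k x \<longleftrightarrow> (norm (x - xstar))\<^sup>2 \<le> 2 * (radius k)\<^sup>2"

lemma bad_energy: "\<not> good k x \<Longrightarrow> 1 \<le> energy k x"
  using A radius_pos[of k] by (simp add: energy_def good_def field_simps)

lemma energy_Suc:
  "energy (Suc k) x = exp (2 * A / (radius k)\<^sup>2 * ((norm (x - xstar))\<^sup>2 / exp (- (\<gamma> * \<mu>)))) * exp (- (4 * A))"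
  using radius_pos[of k] by (simp add: energy_def radius_Suc_sq mult_exp_exp field_simps)

lemma energy_eq:
  "energy k x = exp (2 * A / (radius k)\<^sup>2 * (norm (x - xstar))\<^sup>2) * exp (- (4 * A))"
  using radius_pos[of k] by (simp add: energy_def mult_exp_exp field_simps)

text \<open>The linear term will vanish in expectation, so \<open>a\<close> and
  \<open>\<eta>\<close> are hidden by an existential; what matters is that they do not depend on
  \<open>Y\<close>.\<close>

lemma good_step:
  assumes k: "k \<le> K" and x: "good k x" and g: "norm g \<le> lam k"
  defines "xt \<equiv> x - \<gamma> *\<^sub>R g"
  shows "xt \<in> cball xstar (3 * R)" "norm (F x) \<le> lam k"
    "\<exists>a \<eta>. \<forall>Y. energy (Suc k) (x - \<gamma> *\<^sub>R clip Y (lam k)) \<le> energy k x *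
        (1 + a * ((F xt - Y) \<bullet> \<eta>) + 500 * noise_weight k * (norm (Y - F xt))\<^sup>2
          + 16 * noise_weight k * (norm (g - F x))\<^sup>2)"
proof -
  note B = clipped_step_exp_bound[OF \<gamma>(1) A \<gamma>(2) \<mu> radius_pos radius_le[of k] solution Lipschitz monotone
      x[unfolded good_def] g[unfolded lam_eq[OF k]], folded lam_eq[OF k]]
  show "xt \<in> cball xstar (3 * R)" "norm (F x) \<le> lam k" using B(1,2) by (auto simp: xt_def)
  show "\<exists>a \<eta>. \<forall>Y. energy (Suc k) (x - \<gamma> *\<^sub>R clip Y (lam k)) \<le> energy k x *
        (1 + a * ((F xt - Y) \<bullet> \<eta>) + 500 * noise_weight k * (norm (Y - F xt))\<^sup>2
          + 16 * noise_weight k * (norm (g - F x))\<^sup>2)"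
  proof (intro exI allI)
    fix Y
    show "energy (Suc k) (x - \<gamma> *\<^sub>R clip Y (lam k)) \<le> energy k x *
        (1 + (4 * A * \<gamma> / (exp (- (\<gamma> * \<mu>)) * (radius k)\<^sup>2)) * ((F xt - Y) \<bullet> (x - xstar - \<gamma> *\<^sub>R F xt))
         + 500 * noise_weight k * (norm (Y - F xt))\<^sup>2 + 16 * noise_weight k * (norm (g - F x))\<^sup>2)"
      using mult_right_mono[OF B(3)[of Y], of "exp (- (4 * A))"]
      unfolding energy_Suc energy_eq[of k] noise_weight_def xt_def by (simp only: mult_ac) simp
  qed
qed

lemma measurable_F [measurable]: "F \<in> borel_measurable borel"
proof -
  have "(\<lambda>(x, s). G s x) \<in> borel_measurable (borel \<Otimes>\<^sub>M D)"
    using measurable_pair_swap[OF oracle_measurable] by (simp add: case_prod_beta')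
  then have "(\<lambda>x. D.expectation (\<lambda>s. G s x)) \<in> borel_measurable borel"
    by (rule D.borel_measurable_lebesgue_integral)
  then show ?thesis by (simp add: oracle_mean[abs_def])
qed

lemma measurable_energy [measurable]: "energy k \<in> borel_measurable borel"
  unfolding energy_def[abs_def] by measurable

lemma measurable_good [measurable]: "Measurable.pred borel (good k)"
  unfolding good_def[abs_def] by measurable

text \<open>One factor \<open>1 + \<delta>\<close> is held in reserve for each iteration still to
  come; none is left at \<open>k = Suc K\<close>.\<close>

definition potential :: "nat \<Rightarrow> 'a \<Rightarrow> real" where
  "potential k x = min 1 ((1 + \<delta>) ^ (Suc K - k) * energy k x)"

text \<open>An upper bound for the conditional expectation of the next potential, given the iterate \<open>x\<close> and the
  estimate \<open>g\<close> used in the extrapolation.\<close>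

definition half_potential :: "nat \<Rightarrow> 'a \<Rightarrow> 'a \<Rightarrow> real" where
  "half_potential k x g = min 1 (if good k x then
     (1 + \<delta>) ^ (K - k) * energy k x * (1 + 500 * (noise_weight k * (\<sigma>\<^sup>2 / m k))
        + 16 * noise_weight k * (norm (g - F x))\<^sup>2) else 1)"

lemma measurable_potential [measurable]: "potential k \<in> borel_measurable borel"
  unfolding potential_def[abs_def] by measurable

lemma measurable_half_potential:
  "(\<lambda>(x, g). half_potential k x g) \<in> borel_measurable (borel \<Otimes>\<^sub>M borel)"
  unfolding half_potential_def case_prod_beta' by measurable

lemma potential_bad: "\<not> good k x \<Longrightarrow> potential k x = 1"
proof -
  assume "\<not> good k x"
  then have "1 * 1 \<le> (1 + \<delta>) ^ (Suc K - k) * energy k x"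
    using \<delta>_pos by (intro mult_mono bad_energy) auto
  then show ?thesis by (simp add: potential_def)
qed

lemma potential_nonneg: "0 \<le> potential k x"
  using \<delta>_pos by (simp add: potential_def energy_def)

section \<open>Averaging over the two batches of an iteration\<close>

lemma nn_integral_le_1:
  assumes "\<And>\<omega>. f \<omega> \<le> 1" shows "(\<integral>\<^sup>+ \<omega>. ennreal (f \<omega>) \<partial>M) \<le> 1"
proof -
  have "(\<integral>\<^sup>+ \<omega>. ennreal (f \<omega>) \<partial>M) \<le> (\<integral>\<^sup>+ \<omega>. 1 \<partial>M)"
    using assms by (intro nn_integral_mono) (simp add: ennreal_le_1)
  then show ?thesis by (simp add: M.emeasure_space_1)
qed

text \<open>An integrable majorant allows the passage to the Bochner integral, where a signed linear
  term can be averaged by linearity.\<close>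

lemma nn_integral_le_ennreal:
  fixes f h :: "'w \<Rightarrow> real"
  assumes "\<And>\<omega>. 0 \<le> f \<omega>" "\<And>\<omega>. f \<omega> \<le> h \<omega>" "integrable M h" "M.expectation h \<le> b"
  shows "(\<integral>\<^sup>+ \<omega>. ennreal (f \<omega>) \<partial>M) \<le> ennreal b"
proof -
  have "(\<integral>\<^sup>+ \<omega>. ennreal (f \<omega>) \<partial>M) \<le> (\<integral>\<^sup>+ \<omega>. ennreal (h \<omega>) \<partial>M)"
    using assms(2) by (intro nn_integral_mono ennreal_leI)
  also have "\<dots> = ennreal (M.expectation h)"
    using assms by (intro nn_integral_eq_integral) (auto intro!: AE_I2 order_trans[OF assms(1,2)])
  also have "\<dots> \<le> ennreal b" using assms(4) by (rule ennreal_leI)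
  finally show ?thesis .
qed

text \<open>With the iterate and the extrapolation estimate frozen, only the update batch is random:
  the linear term averages to zero and the squared deviation to at most
  \<open>\<sigma>\<^sup>2 / m k\<close>. If \<open>x\<close> is not good, the right-hand side is
  already 1.\<close>

lemma update_step:
  assumes k: "k \<le> K" and g: "norm g \<le> lam k"
  shows "(\<integral>\<^sup>+ \<omega>. ennreal (potential (Suc k) (x - \<gamma> *\<^sub>R grad 2 k (samples \<omega>) (x - \<gamma> *\<^sub>R g))) \<partial>M)
    \<le> ennreal (half_potential k x g)" (is "?I \<le> _")
proof (cases "good k x")
  case False
  have "?I \<le> 1" by (rule nn_integral_le_1) (simp add: potential_def)
  then show ?thesis using False by (simp add: half_potential_def)
next
  case True
  let ?xt = "x - \<gamma> *\<^sub>R g"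
  note Q = good_step[OF k True g]
  obtain a \<eta> where step: "\<And>Y. energy (Suc k) (x - \<gamma> *\<^sub>R clip Y (lam k)) \<le> energy k x *
        (1 + a * ((F ?xt - Y) \<bullet> \<eta>) + 500 * noise_weight k * (norm (Y - F ?xt))\<^sup>2
          + 16 * noise_weight k * (norm (g - F x))\<^sup>2)"
    using Q(3) by blast
  obtain Y where Y: "\<And>\<omega>. grad 2 k (samples \<omega>) ?xt = clip (Y \<omega>) (lam k)"
    "integrable M Y" "M.expectation Y = F ?xt"
    "integrable M (\<lambda>\<omega>. (norm (Y \<omega> - F ?xt))\<^sup>2)"
    "M.expectation (\<lambda>\<omega>. (norm (Y \<omega> - F ?xt))\<^sup>2) \<le> \<sigma>\<^sup>2 / m k"
    by (rule batch_mean[of 2 k ?xt "F ?xt" "\<sigma>\<^sup>2"])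
       (use k variance[OF Q(1)] oracle_integrable oracle_mean in auto)
  define C where "C = (1 + \<delta>) ^ (K - k) * energy k x"
  have C: "0 < C" using \<delta>_pos by (simp add: C_def energy_def zero_less_mult_iff)
  define h where "h \<omega> = C * (1 + a * ((F ?xt - Y \<omega>) \<bullet> \<eta>) + 500 * noise_weight k * (norm (Y \<omega> - F ?xt))\<^sup>2
          + 16 * noise_weight k * (norm (g - F x))\<^sup>2)" for \<omega>
  have int: "integrable M (\<lambda>\<omega>. (F ?xt - Y \<omega>) \<bullet> \<eta>)" using Y(2) by auto
  have mean0: "M.expectation (\<lambda>\<omega>. (F ?xt - Y \<omega>) \<bullet> \<eta>) = 0"
    using Y(2,3) by (simp add: M.prob_space)
  have "?I \<le> ennreal (C * (1 + 500 * (noise_weight k * (\<sigma>\<^sup>2 / m k)) + 16 * noise_weight k * (norm (g - F x))\<^sup>2))"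
  proof (rule nn_integral_le_ennreal[where h = h])
    show "integrable M h" unfolding h_def using int Y(4) by auto
    fix \<omega>
    show "0 \<le> potential (Suc k) (x - \<gamma> *\<^sub>R grad 2 k (samples \<omega>) ?xt)" by (rule potential_nonneg)
    have "potential (Suc k) (x - \<gamma> *\<^sub>R grad 2 k (samples \<omega>) ?xt)
        \<le> (1 + \<delta>) ^ (K - k) * energy (Suc k) (x - \<gamma> *\<^sub>R clip (Y \<omega>) (lam k))"
      by (simp add: potential_def Y(1))
    also have "\<dots> \<le> (1 + \<delta>) ^ (K - k) * (energy k x * (1 + a * ((F ?xt - Y \<omega>) \<bullet> \<eta>) + 500 * noise_weight k * (norm (Y \<omega> - F ?xt))\<^sup>2
          + 16 * noise_weight k * (norm (g - F x))\<^sup>2))"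
      using \<delta>_pos by (intro mult_left_mono step) auto
    finally show "potential (Suc k) (x - \<gamma> *\<^sub>R grad 2 k (samples \<omega>) ?xt) \<le> h \<omega>"
      by (simp only: h_def C_def mult.assoc)
  next
    have "M.expectation h = C * (1 + 500 * noise_weight k * M.expectation (\<lambda>\<omega>. (norm (Y \<omega> - F ?xt))\<^sup>2)
        + 16 * noise_weight k * (norm (g - F x))\<^sup>2)"
      unfolding h_def using int Y(4) mean0 by (simp add: M.prob_space)
    also have "\<dots> \<le> C * (1 + 500 * noise_weight k * (\<sigma>\<^sup>2 / m k) + 16 * noise_weight k * (norm (g - F x))\<^sup>2)"
      using C Y(5) noise_weight_nonneg by (intro mult_left_mono add_mono) auto
    finally show "M.expectation h \<le> C * (1 + 500 * (noise_weight k * (\<sigma>\<^sup>2 / m k)) + 16 * noise_weight k * (norm (g - F x))\<^sup>2)"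
      by (simp only: mult.assoc)
  qed
  moreover have "?I \<le> 1" by (rule nn_integral_le_1) (simp add: potential_def)
  ultimately show ?thesis using True by (simp add: half_potential_def C_def[symmetric] min_def)
qed

text \<open>Averaging the extrapolation error brings the total noise to at most
  \<open>\<delta>\<close>, which spends one reserved factor \<open>1 + \<delta>\<close>.\<close>

lemma extrapolation_step:
  assumes k: "k \<le> K"
  shows "(\<integral>\<^sup>+ \<omega>. ennreal (half_potential k x (grad 1 k (samples \<omega>) x)) \<partial>M) \<le> ennreal (potential k x)" (is "?I \<le> _")
proof -
  have I1: "?I \<le> 1" by (rule nn_integral_le_1) (simp add: half_potential_def)
  show ?thesis
  proof (cases "good k x")
    case False
    then show ?thesis using I1 by (simp add: potential_bad)
  next
    case True
    \<comment> \<open>With estimate 0 the extrapolated point is \<open>x\<close> itself, which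
      places \<open>x\<close> in the ball.\<close>
    note Q = good_step[OF k True, of 0]
    have xQ: "x \<in> cball xstar (3 * R)" and Fx: "norm (F x) \<le> lam k"
      using Q(1,2) lam_pos[OF k] by auto
    obtain Y where Y: "\<And>\<omega>. grad 1 k (samples \<omega>) x = clip (Y \<omega>) (lam k)"
      "integrable M Y" "M.expectation Y = F x"
      "integrable M (\<lambda>\<omega>. (norm (Y \<omega> - F x))\<^sup>2)"
      "M.expectation (\<lambda>\<omega>. (norm (Y \<omega> - F x))\<^sup>2) \<le> \<sigma>\<^sup>2 / m k"
      by (rule batch_mean[of 1 k x "F x" "\<sigma>\<^sup>2"])
         (use k variance[OF xQ] oracle_integrable oracle_mean in auto)
    define C where "C = (1 + \<delta>) ^ (K - k) * energy k x"
    have C: "0 < C" using \<delta>_pos by (simp add: C_def energy_def zero_less_mult_iff)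
    let ?v = "noise_weight k * (\<sigma>\<^sup>2 / m k)"
    have v: "0 \<le> ?v" using noise_weight_nonneg by simp
    define h where "h \<omega> = C * (1 + 500 * ?v + 16 * noise_weight k * (norm (Y \<omega> - F x))\<^sup>2)" for \<omega>
    have "?I \<le> ennreal (C * (1 + \<delta>))"
    proof (rule nn_integral_le_ennreal[where h = h])
      show "integrable M h" unfolding h_def using Y(4) by auto
      fix \<omega>
      have "0 \<le> C * (1 + 500 * ?v + 16 * noise_weight k * (norm (grad 1 k (samples \<omega>) x - F x))\<^sup>2)"
        using C v noise_weight_nonneg by (intro mult_nonneg_nonneg add_nonneg_nonneg) auto
      then show "0 \<le> half_potential k x (grad 1 k (samples \<omega>) x)"
        using True by (simp add: half_potential_def C_def)
      have "half_potential k x (grad 1 k (samples \<omega>) x)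
          \<le> C * (1 + 500 * ?v + 16 * noise_weight k * (norm (clip (Y \<omega>) (lam k) - F x))\<^sup>2)"
        using True by (simp add: half_potential_def C_def Y(1) del: One_nat_def)
      \<comment> \<open>The extrapolation error enters only squared, so nonexpansiveness handles the
        clipping and no bias term arises.\<close>
      also have "\<dots> \<le> h \<omega>"
        unfolding h_def using C noise_weight_nonneg clip_nonexpansive[OF lam_pos[OF k] Fx, of "Y \<omega>"]
        by (intro mult_left_mono add_left_mono power_mono) auto
      finally show "half_potential k x (grad 1 k (samples \<omega>) x) \<le> h \<omega>" .
    next
      have "M.expectation h = C * (1 + 500 * ?v + 16 * noise_weight k * M.expectation (\<lambda>\<omega>. (norm (Y \<omega> - F x))\<^sup>2))"
        unfolding h_def using Y(4) by (simp add: M.prob_space)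
      also have "\<dots> \<le> C * (1 + 500 * ?v + 16 * noise_weight k * (\<sigma>\<^sup>2 / m k))"
        using C Y(5) noise_weight_nonneg by (intro mult_left_mono add_left_mono) auto
      also have "\<dots> = C * (1 + 516 * ?v)" by (simp add: algebra_simps)
      also have "\<dots> \<le> C * (1 + \<delta>)"
        using C noise_weight_variance[OF k] by (intro mult_left_mono) auto
      finally show "M.expectation h \<le> C * (1 + \<delta>)" .
    qed
    also have "C * (1 + \<delta>) = (1 + \<delta>) ^ (Suc K - k) * energy k x"
      using k by (simp add: C_def Suc_diff_le)
    finally show ?thesis using I1 by (simp add: potential_def min_def)
  qed
qed

text \<open>The batches are averaged out in reverse order of drawing: first the update batch given
  everything earlier, then the extrapolation batch given the past iterations.\<close>

lemma potential_supermartingale: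
  assumes k: "k \<le> K"
  shows "(\<integral>\<^sup>+ \<omega>. ennreal (potential (Suc k) (iter (Suc k) (samples \<omega>))) \<partial>M)
    \<le> (\<integral>\<^sup>+ \<omega>. ennreal (potential k (iter k (samples \<omega>))) \<partial>M)"
proof -
  define A2 where "A2 = past k \<union> batch 1 k"
  have A2: "A2 \<subseteq> past (Suc K)" "A2 \<inter> batch 2 k = {}" "past k \<subseteq> A2" "batch 1 k \<subseteq> A2"
    using k by (auto simp: A2_def past_def batch_def)
  have A1: "past k \<subseteq> past (Suc K)" "past k \<inter> batch 1 k = {}"
    using k by (auto simp: past_def batch_def)
  \<comment> \<open>The state holds both the iterate and the extrapolation estimate, so that the
    query point of the update is a function of it.\<close>
  define U where "U z = (iter k z, grad 1 k z (iter k z))" for z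
  note [measurable] = measurable_iter[OF A2(3)]
  have [measurable]: "(\<lambda>z. grad 1 k z (iter k z)) \<in> borel_measurable (PiM A2 (\<lambda>_. D))"
    by (rule measurable_grad[OF A2(4)]; measurable)
  have U: "U \<in> borel_measurable (PiM A2 (\<lambda>_. D))" "\<And>z. U (restrict z A2) = U z"
    unfolding U_def borel_prod[symmetric] by (measurable, simp add: iter_restrict[OF A2(3)] grad_restrict[OF A2(4)] del: One_nat_def)
  have "(\<integral>\<^sup>+ \<omega>. ennreal (potential (Suc k) (iter (Suc k) (samples \<omega>))) \<partial>M)
    = (\<integral>\<^sup>+ \<omega>. ennreal (potential (Suc k) (fst (U (samples \<omega>)) - \<gamma> *\<^sub>R grad 2 k (samples \<omega>)
          ((\<lambda>u. fst u - \<gamma> *\<^sub>R snd u) (U (samples \<omega>))))) \<partial>M)"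
    by (simp add: iter_Suc U_def)
  also have "\<dots> = (\<integral>\<^sup>+ \<omega>. (\<integral>\<^sup>+ \<omega>'. ennreal (potential (Suc k) (fst (U (samples \<omega>)) - \<gamma> *\<^sub>R grad 2 k (samples \<omega>')
          ((\<lambda>u. fst u - \<gamma> *\<^sub>R snd u) (U (samples \<omega>))))) \<partial>M) \<partial>M)"
    by (rule nn_integral_fresh_batch[OF _ k A2(1,2) U, where \<psi> = "\<lambda>c g. ennreal (potential (Suc k) (fst c - \<gamma> *\<^sub>R g))"])
       (auto simp: borel_prod[symmetric])
  \<comment> \<open>The extrapolation estimate is clipped, which supplies the norm bound that
    \<open>update_step\<close> asks for.\<close>
  also have "\<dots> \<le> (\<integral>\<^sup>+ \<omega>. ennreal (half_potential k (iter k (samples \<omega>)) (grad 1 k (samples \<omega>) (iter k (samples \<omega>)))) \<partial>M)"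
    unfolding U_def fst_conv snd_conv
    by (intro nn_integral_mono update_step[OF k])
       (simp add: grad_def clipped_batch_def norm_clip_le lam_pos[OF k])
  also have "\<dots> = (\<integral>\<^sup>+ \<omega>. (\<integral>\<^sup>+ \<omega>'. ennreal (half_potential k (iter k (samples \<omega>)) (grad 1 k (samples \<omega>') (iter k (samples \<omega>)))) \<partial>M) \<partial>M)"
    by (rule nn_integral_fresh_batch[OF _ k A1 measurable_iter iter_restrict, where y = "\<lambda>x. x" and \<psi> = "\<lambda>x g. ennreal (half_potential k x g)"])
       (use measurable_half_potential in \<open>auto simp: case_prod_beta'\<close>)
  also have "\<dots> \<le> (\<integral>\<^sup>+ \<omega>. ennreal (potential k (iter k (samples \<omega>))) \<partial>M)"
    by (intro nn_integral_mono extrapolation_step[OF k])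
  finally show ?thesis .
qed

section \<open>Failure probability of the last iterate\<close>

lemma potential_iter:
  "k \<le> Suc K \<Longrightarrow> (\<integral>\<^sup>+ \<omega>. ennreal (potential k (iter k (samples \<omega>))) \<partial>M) \<le> ennreal (potential 0 x0)"
proof (induction k)
  case 0
  then show ?case by (simp add: iter_0 M.emeasure_space_1)
next
  case (Suc k)
  then show ?case using potential_supermartingale[of k] by (meson Suc_leD Suc_le_mono order_trans)
qed

text \<open>All reserved factors together cost at most \<open>exp A\<close>, while a starting
  distance of at most \<open>R\<close> makes the energy at most
  \<open>exp (- (2 * A))\<close>.\<close>

lemma potential_start: "potential 0 x0 \<le> exp (- A)"
proof -
  have "(1 + \<delta>) ^ Suc K \<le> exp \<delta> ^ Suc K"
    using \<delta>_pos by (intro power_mono) (auto intro: exp_ge_add_one_self)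
  also have "\<dots> = exp (real (Suc K) * \<delta>)" by (rule exp_of_nat_mult[symmetric])
  also have "real (Suc K) * \<delta> = A" by (simp add: \<delta>_def field_simps)
  finally have 1: "(1 + \<delta>) ^ Suc K \<le> exp A" .
  have "(norm (x0 - xstar))\<^sup>2 \<le> R\<^sup>2" using R by (intro power_mono) auto
  then have "(norm (x0 - xstar))\<^sup>2 / (radius 0)\<^sup>2 - 2 \<le> -1"
    using R by (simp add: radius_def)
  then have "2 * A * ((norm (x0 - xstar))\<^sup>2 / (radius 0)\<^sup>2 - 2) \<le> 2 * A * (-1)"
    using A by (intro mult_left_mono) auto
  then have 2: "energy 0 x0 \<le> exp (- (2 * A))" by (simp add: energy_def)
  have "potential 0 x0 \<le> (1 + \<delta>) ^ Suc K * energy 0 x0"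
    by (simp add: potential_def)
  also have "\<dots> \<le> exp A * exp (- (2 * A))"
    using 1 2 by (intro mult_mono) (auto simp: energy_def)
  finally show ?thesis by (simp add: mult_exp_exp)
qed

text \<open>As in Markov's inequality, the final potential dominates the indicator of
  failure.\<close>

lemma prob_bad: "M.prob {\<omega> \<in> space M. \<not> good (Suc K) (iter (Suc K) (samples \<omega>))} \<le> exp (- A)"
proof -
  note [measurable] = measurable_iter_samples[OF order_refl]
  let ?B = "{\<omega> \<in> space M. \<not> good (Suc K) (iter (Suc K) (samples \<omega>))}"
  have "emeasure M ?B = (\<integral>\<^sup>+ \<omega>. indicator ?B \<omega> \<partial>M)" by simp
  also have "\<dots> \<le> (\<integral>\<^sup>+ \<omega>. ennreal (potential (Suc K) (iter (Suc K) (samples \<omega>))) \<partial>M)"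
    by (intro nn_integral_mono) (auto simp: indicator_def potential_bad)
  also have "\<dots> \<le> ennreal (exp (- A))"
    using potential_iter[OF order_refl] ennreal_leI[OF potential_start] by (rule order_trans)
  finally show ?thesis by (simp add: M.emeasure_eq_measure)
qed

lemma prob_good: "1 - exp (- A) \<le> M.prob {\<omega> \<in> space M. good (Suc K) (iter (Suc K) (samples \<omega>))}"
proof -
  note [measurable] = measurable_iter_samples[OF order_refl]
  have "M.prob {\<omega> \<in> space M. \<not> good (Suc K) (iter (Suc K) (samples \<omega>))}
      = 1 - M.prob {\<omega> \<in> space M. good (Suc K) (iter (Suc K) (samples \<omega>))}"
    by (rule M.prob_neg) measurable
  then show ?thesis using prob_bad by simp
qed

end

section \<open>From the stated hypotheses to the abstract setting\<close>

theorem theoremC3: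
  fixes D :: "'s measure"
    and M :: "'w measure"
    and G :: "'s \<Rightarrow> real ^ 'd \<Rightarrow> real ^ 'd"
    and F :: "real ^ 'd \<Rightarrow> real ^ 'd"
    and \<xi> :: "nat \<Rightarrow> nat \<Rightarrow> nat \<Rightarrow> 'w \<Rightarrow> 's"
    and x0 xstar :: "real ^ 'd"
    and R \<sigma> L \<mu> \<gamma> \<beta> :: real
    and lam :: "nat \<Rightarrow> real"
    and m :: "nat \<Rightarrow> nat"
    and K :: nat
  assumes D: "prob_space D" and M: "prob_space M"
    and oracle_measurable: "(\<lambda>(s, x). G s x) \<in> borel_measurable (D \<Otimes>\<^sub>M borel)"
    and oracle_integrable: "\<And>x. integrable D (\<lambda>s. G s x)"
    and oracle_mean: "\<And>x. F x = prob_space.expectation D (\<lambda>s. G s x)"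
    and samples_indep: "prob_space.indep_vars M (\<lambda>_. D) (\<lambda>(j, i, k). \<xi> j i k)
           {(j, i, k). j \<in> {1, 2} \<and> i \<in> {1..m k} \<and> k \<le> K}"
    and samples_distr: "\<And>j i k. j \<in> {1, 2} \<Longrightarrow> i \<in> {1..m k} \<Longrightarrow> k \<le> K \<Longrightarrow> distr M D (\<xi> j i k) = D"
    and R: "0 < R" "norm (x0 - xstar) \<le> R"
    and variance: "\<And>x. x \<in> cball xstar (3 * R) \<Longrightarrow>
           integrable D (\<lambda>s. (norm (G s x - F x))\<^sup>2) \<and>
           prob_space.expectation D (\<lambda>s. (norm (G s x - F x))\<^sup>2) \<le> \<sigma>\<^sup>2"
    and Lipschitz: "\<And>x y. x \<in> cball xstar (3 * R) \<Longrightarrow> y \<in> cball xstar (3 * R) \<Longrightarrow>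
           norm (F x - F y) \<le> L * norm (x - y)"
    and solution: "F xstar = 0" "\<And>y. F y = 0 \<Longrightarrow> y = xstar"
    and monotone: "0 \<le> \<mu>"
          "\<And>x. x \<in> cball xstar (3 * R) \<Longrightarrow> F x \<bullet> (x - xstar) \<ge> \<mu> * (norm (x - xstar))\<^sup>2"
    and \<beta>: "0 < \<beta>" "\<beta> \<le> 1" "ln (6 * (real K + 1) / \<beta>) \<ge> 1"
    and \<gamma>: "0 < \<gamma>" "\<gamma> \<le> 1 / (650 * L * ln (6 * (real K + 1) / \<beta>))"
    and lam: "\<And>k. k \<le> K \<Longrightarrow>
           lam k = exp (- \<gamma> * \<mu> * (1 + real k / 2)) * R / (120 * \<gamma> * ln (6 * (real K + 1) / \<beta>))"
    and m: "\<And>k. k \<le> K \<Longrightarrow>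
           real (m k) \<ge> max 1 (264600 * \<gamma>\<^sup>2 * (real K + 1) * \<sigma>\<^sup>2 * ln (6 * (real K + 1) / \<beta>)
                               / (exp (- \<gamma> * \<mu> * real k) * R\<^sup>2))"
  shows "prob_space.prob M {\<omega> \<in> space M.
           (norm (clipped_SEG G \<gamma> \<gamma> lam lam m m (\<lambda>i k. \<xi> 1 i k \<omega>) (\<lambda>i k. \<xi> 2 i k \<omega>) x0 (K + 1)
                  - xstar))\<^sup>2
             \<le> 2 * exp (- \<gamma> * \<mu> * (real K + 1)) * R\<^sup>2} \<ge> 1 - \<beta>"
proof -
  define A where "A = ln (6 * (real K + 1) / \<beta>)"
  have A: "1 \<le> A" using \<beta>(3) by (simp add: A_def)
  \<comment> \<open>Since \<open>1 / 0 = 0\<close>, the case \<open>L = 0\<close> contradicts the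
    positivity of \<open>\<gamma>\<close> as well.\<close>
  have "0 < 1 / (650 * L * A)" using \<gamma> unfolding A_def by linarith
  then have L: "0 < L" using A by (simp add: zero_less_mult_iff)
  have \<gamma>LA: "\<gamma> * L * A \<le> 1 / 650" using \<gamma>(2)[folded A_def] L A by (simp add: field_simps)
  \<comment> \<open>Monotonicity and Lipschitz continuity are compared at a point at distance
    \<open>R\<close> from \<open>xstar\<close>, which exists because the dimension is
    positive.\<close>
  have \<mu>L: "\<mu> \<le> L"
  proof -
    obtain b :: "real ^ 'd" where b: "norm b = R" using vector_choose_size R(1) by (meson less_imp_le)
    have Q: "xstar + b \<in> cball xstar (3 * R)" "xstar \<in> cball xstar (3 * R)"
      using b R(1) by (auto simp: dist_norm)
    have "\<mu> * R\<^sup>2 \<le> F (xstar + b) \<bullet> b" using monotone(2)[OF Q(1)] b by simp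
    also have "\<dots> \<le> norm (F (xstar + b)) * norm b" by (rule norm_cauchy_schwarz)
    also have "\<dots> \<le> (L * R) * R"
      using Lipschitz[OF Q] solution(1) b R(1) L by (intro mult_mono) auto
    finally show ?thesis using R(1) by (simp add: power2_eq_square mult.assoc)
  qed
  interpret M: prob_space M by (rule M)
  interpret D: prob_space D by (rule D)
  interpret clipped_SEG_monotone M D G \<xi> x0 \<gamma> lam m K F xstar R \<sigma> L \<mu> A
  proof unfold_locales
    fix k assume k: "k \<le> K"
    note mk = m[OF k, folded A_def]
    show "0 < m k" using mk by simp
    show "264600 * \<gamma>\<^sup>2 * (real K + 1) * \<sigma>\<^sup>2 * A / (exp (- \<gamma> * \<mu> * real k) * R\<^sup>2) \<le> real (m k)"
      using mk by (rule order_trans[OF max.cobounded2])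
    show "lam k = exp (- \<gamma> * \<mu> * (1 + real k / 2)) * R / (120 * \<gamma> * A)"
      using lam[OF k] by (simp only: A_def)
  qed (fact oracle_measurable samples_indep samples_distr oracle_integrable oracle_mean R variance
      Lipschitz solution(1) monotone \<mu>L A \<gamma>(1) \<gamma>LA)+
  \<comment> \<open>The failure bound is smaller than \<open>\<beta>\<close> by the factor
    \<open>6 * (real K + 1)\<close>.\<close>
  have "exp (- A) = \<beta> / (6 * (real K + 1))"
    using \<beta> by (simp add: A_def exp_minus)
  also have "\<dots> \<le> \<beta>" using \<beta> by (simp add: field_simps)
  finally have "1 - \<beta> \<le> M.prob {\<omega> \<in> space M. good (Suc K) (iter (Suc K) (samples \<omega>))}"
    using prob_good by linarith
  then show ?thesis
    by (simp add: good_def radius_sq iter_def samples_def mult_ac add_ac del: clipped_SEG.simps)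
qed

end
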